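(* Let $\mathbf L$ be a self-adjoint operator that is bounded below on $L^2[(a,b),w]$, acting by $\ell$ on a domain $\mathcal D_{\mathbf L}$ that includes a complete orthogonal system of eigenfunctions of $\mathbf L$, enumerated as $\{P_k\}_{k=0}^\infty$. Let $\mathbf L$ be an extension of the minimal (symmetric, closed) operator $\mathbf L_{\min}=\{\ell,\mathcal D_{\min}\}$, and let $\mathbf L_{\min}$ have deficiency indices $(m,m)$. Let $n\in\mathbb N$, and let the minimal operator $\mathbf L_{\min}^n=\{\ell^n,\mathcal D^n_{\min}\}$ have deficiency indices $(nm,nm)$. Then the GKN conditions for the $2n$th left-definite space generated by $\mathbf L$ are given by some $\{P_{k_1},\dots,P_{k_{nm}}\}$; that is, there exist indices $k_1,\dots,k_{nm}$ such that $P_{k_1},\dots,P_{k_{nm}}$ are linearly independent modulo $\mathcal D^n_{\min}$, satisfy $[P_{k_i},P_{k_j}]_n|_a^b=0$ for all $i,j$, and the $2n$th left-definite space $\mathcal V_{2n}=\mathcal D(\mathbf L^n)$ equals $$\{f\in\mathcal D^n_{\max}: [f,P_{k_i}]_n|_a^b=0,\ i=1,\dots,nm\}.$$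
   Context: $L^2[(a,b),w]$ has inner product $\langle f,g\rangle=\int_a^b f\overline g\,w\,dx$. $\ell[f]=-\frac1w\left((pf')'+qf\right)$ is a Sturm--Liouville expression with $p,w>0$ a.e. on $(a,b)$, $q$ real-valued, $1/p,q,w\in L^1_{\rm loc}(a,b)$, and $\ell^n$ denotes its $n$-fold composition, a formally symmetric differential expression of order $2n$ (with $\ell^1=\ell$). Left-definite theory: if $\mathbf A$ is a self-adjoint operator in a Hilbert space $\mathcal H$ bounded below by $kI$, $k>0$, then for $r>0$ the $r$th left-definite space associated with $(\mathcal H,\mathbf A)$ is $\mathcal V_r=\mathcal D(\mathbf A^{r/2})$ with inner product $\langle x,y\rangle_r=\langle\mathbf A^{r/2}x,\mathbf A^{r/2}y\rangle$; in particular $\mathcal V_{2n}=\mathcal D(\mathbf A^n)$. For operators merely bounded below one first applies a shift $\mathbf A+cI$ (which does not change $\mathcal D(\mathbf A^n)$). $\mathcal{D}^n_{\max}=\{f:(a,b)\to\mathbb{C} : f^{(k)}\in AC_{\rm loc}(a,b),\ k=0,\dots,2n-1;\ f,\ell^n[f]\in L^2[(a,b),w]\}$. For $f,g\in\mathcal D^n_{\max}$, $[f,g]_n|_a^b=\int_a^b\{\ell^n[f]\overline g-\ell^n[\overline g]f\}w\,dx$. $\mathcal D^n_{\min}=\{f\in\mathcal D^n_{\max}:[f,g]_n|_a^b=0\ \forall g\in\mathcal D^n_{\max}\}$; for $n=1$ the superscript is dropped. $\{\ell^n,\mathcal D^n_{\min}\}$ and $\{\ell^n,\mathcal D^n_{\max}\}$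 are adjoints of one another. The deficiency indices of $\mathbf L^n_{\min}$ are $(\dim\mathcal D^n_+,\dim\mathcal D^n_-)$ with $\mathcal D^n_\pm=\{f\in\mathcal D^n_{\max}:\ell^n[f]=\pm if\}$. Functions $w_1,\dots,w_r\in\mathcal D^n_{\max}$ are linearly independent modulo $\mathcal D^n_{\min}$ if $\sum\alpha_iw_i\in\mathcal D^n_{\min}$ implies all $\alpha_i=0$.
   Formalization: In the maximal domain, local absolute continuity is required of the quasi-derivatives f, pf', ℓf, p(ℓf)', ... instead of f, f', ..., f^(2n-1); these agree for smooth p, q, w with p, w > 0, and for rough coefficients the version with ordinary derivatives fails. *)

theory Defs
  imports "HOL-Analysis.Analysis" "HOL-Library.Function_Algebras"
begin

subsection \<open>Sturm--Liouville expressions and the weighted space \<open>L\<^sup>2[(a,b),w]\<close>\<close>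

record sl_expr =
  left_end :: ereal
  right_end :: ereal
  coeff_p :: "real \<Rightarrow> real"
  coeff_q :: "real \<Rightarrow> real"
  weight :: "real \<Rightarrow> real"

definition sl_ivl :: "sl_expr \<Rightarrow> real set" where
  "sl_ivl S = einterval (left_end S) (right_end S)"

definition loc_integrable :: "real set \<Rightarrow> (real \<Rightarrow> real) \<Rightarrow> bool" where
  "loc_integrable I g \<longleftrightarrow> (\<forall>c d. {c..d} \<subseteq> I \<longrightarrow> g absolutely_integrable_on {c..d})"

definition sturm_liouville :: "sl_expr \<Rightarrow> bool" where
  "sturm_liouville S \<longleftrightarrow>
     left_end S < right_end S \<and>
     (AE x\<in>sl_ivl S in lebesgue. coeff_p S x > 0 \<and> weight S x > 0) \<and>
     loc_integrable (sl_ivl S) (\<lambda>x. 1 / coeff_p S x) \<and>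
     loc_integrable (sl_ivl S) (coeff_q S) \<and>
     loc_integrable (sl_ivl S) (weight S)"

text \<open>Elements of \<open>L\<^sup>2\<close> are functions, not classes; their values outside the interval are
  irrelevant, and equality in \<open>L\<^sup>2\<close> is \<open>ae_eq\<close>.\<close>

definition ae_eq :: "sl_expr \<Rightarrow> (real \<Rightarrow> complex) \<Rightarrow> (real \<Rightarrow> complex) \<Rightarrow> bool" where
  "ae_eq S f g \<longleftrightarrow> (AE x\<in>sl_ivl S in lebesgue. f x = g x)"

definition L2 :: "sl_expr \<Rightarrow> (real \<Rightarrow> complex) set" where
  "L2 S = {f. set_borel_measurable lebesgue (sl_ivl S) f \<and>
              set_integrable lebesgue (sl_ivl S) (\<lambda>x. (cmod (f x))\<^sup>2 * weight S x)}"

definition L2_inner :: "sl_expr \<Rightarrow> (real \<Rightarrow> complex) \<Rightarrow> (real \<Rightarrow> complex) \<Rightarrow> complex" where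
  "L2_inner S f g = (CLINT x:sl_ivl S|lebesgue. f x * cnj (g x) * of_real (weight S x))"


subsection \<open>Local absolute continuity\<close>

definition abs_cont_on :: "real \<Rightarrow> real \<Rightarrow> (real \<Rightarrow> complex) \<Rightarrow> bool" where
  "abs_cont_on c d f \<longleftrightarrow>
     (\<forall>\<epsilon>>0. \<exists>\<delta>>0. \<forall>(N::nat) s t.
        (\<forall>i<N. c \<le> s i \<and> s i \<le> t i \<and> t i \<le> d) \<and>
        disjoint_family_on (\<lambda>i. {s i<..<t i}) {..<N} \<and>
        (\<Sum>i<N. t i - s i) < \<delta>
        \<longrightarrow> (\<Sum>i<N. cmod (f (t i) - f (s i))) < \<epsilon>)"

definition AC_loc :: "sl_expr \<Rightarrow> (real \<Rightarrow> complex) \<Rightarrow> bool" where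
  "AC_loc S f \<longleftrightarrow> (\<forall>c d. {c..d} \<subseteq> sl_ivl S \<longrightarrow> abs_cont_on c d f)"

text \<open>The derivative of a locally absolutely continuous function exists only almost everywhere,
  and \<open>p\<close>, \<open>q\<close>, \<open>w\<close> are given only almost everywhere. So an expression such as \<open>pf'\<close> is an
  almost-everywhere class, and \<open>pf' \<in> AC\<^sub>l\<^sub>o\<^sub>c\<close> means that this class contains a (necessarily
  unique) locally absolutely continuous function. \<open>has_ac_deriv S f g\<close> says that \<open>f\<close> has such a
  representative, with derivative \<open>g\<close>. By Lebesgue's theorem such a \<open>g\<close> exists whenever the
  representative does, and it is unique up to null sets.\<close>

definition has_ac_deriv :: "sl_expr \<Rightarrow> (real \<Rightarrow> complex) \<Rightarrow> (real \<Rightarrow> complex) \<Rightarrow> bool" where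
  "has_ac_deriv S f g \<longleftrightarrow>
     (\<exists>u. AC_loc S u \<and> ae_eq S u f \<and>
          (AE x\<in>sl_ivl S in lebesgue. (u has_vector_derivative g x) (at x)))"

definition ac_deriv :: "sl_expr \<Rightarrow> (real \<Rightarrow> complex) \<Rightarrow> real \<Rightarrow> complex" where
  "ac_deriv S f = (SOME g. has_ac_deriv S f g)"

definition AC_loc_class :: "sl_expr \<Rightarrow> (real \<Rightarrow> complex) \<Rightarrow> bool" where
  "AC_loc_class S f \<longleftrightarrow> (\<exists>g. has_ac_deriv S f g)"


subsection \<open>The expression \<open>\<ell>\<close>, its powers, maximal and minimal domains\<close>

definition sl :: "sl_expr \<Rightarrow> (real \<Rightarrow> complex) \<Rightarrow> real \<Rightarrow> complex" where
  "sl S f = (\<lambda>x. - (1 / of_real (weight S x)) *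
       (ac_deriv S (\<lambda>y. of_real (coeff_p S y) * ac_deriv S f y) x + of_real (coeff_q S x) * f x))"

definition sl_pow :: "sl_expr \<Rightarrow> nat \<Rightarrow> (real \<Rightarrow> complex) \<Rightarrow> real \<Rightarrow> complex" where
  "sl_pow S n = sl S ^^ n"

text \<open>Under \<open>1/p, q, w \<in> L\<^sup>1\<^sub>l\<^sub>o\<^sub>c\<close> the successive derivatives attached to the powers of \<open>\<ell>\<close> are the
  quasi-derivatives \<open>f, pf', \<ell>f, p(\<ell>f)', \<ell>\<^sup>2f, \<dots>\<close>. If \<open>p, q, w\<close> are smooth and \<open>p, w > 0\<close>, then
  \<open>f, pf', \<dots>\<close> are all locally absolutely continuous up to order \<open>2n - 1\<close> if and only if
  \<open>f, f', \<dots>, f\<^bsup>(2n-1)\<^esup>\<close> are.\<close>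

definition quasi_deriv :: "sl_expr \<Rightarrow> nat \<Rightarrow> (real \<Rightarrow> complex) \<Rightarrow> real \<Rightarrow> complex" where
  "quasi_deriv S k f =
     (if even k then sl_pow S (k div 2) f
      else (\<lambda>x. of_real (coeff_p S x) * ac_deriv S (sl_pow S (k div 2) f) x))"

text \<open>A function \<open>(a,b) \<rightarrow> \<complex>\<close> is represented by its extension by zero, so that the domains are
  vector spaces of functions on \<open>(a,b)\<close> and their dimensions are the right ones.\<close>

definition sl_max :: "sl_expr \<Rightarrow> nat \<Rightarrow> (real \<Rightarrow> complex) set" where
  "sl_max S n = {f. (\<forall>x. x \<notin> sl_ivl S \<longrightarrow> f x = 0) \<and>
                    AC_loc S f \<and> (\<forall>k<2*n. AC_loc_class S (quasi_deriv S k f)) \<and>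
                    f \<in> L2 S \<and> sl_pow S n f \<in> L2 S}"

definition sl_bracket :: "sl_expr \<Rightarrow> nat \<Rightarrow> (real \<Rightarrow> complex) \<Rightarrow> (real \<Rightarrow> complex) \<Rightarrow> complex" where
  "sl_bracket S n f g =
     (CLINT x:sl_ivl S|lebesgue.
        (sl_pow S n f x * cnj (g x) - sl_pow S n (\<lambda>y. cnj (g y)) x * f x) * of_real (weight S x))"

definition sl_min :: "sl_expr \<Rightarrow> nat \<Rightarrow> (real \<Rightarrow> complex) set" where
  "sl_min S n = {f \<in> sl_max S n. \<forall>g\<in>sl_max S n. sl_bracket S n f g = 0}"

definition lin_indep_mod_min :: "sl_expr \<Rightarrow> nat \<Rightarrow> nat \<Rightarrow> (nat \<Rightarrow> real \<Rightarrow> complex) \<Rightarrow> bool" where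
  "lin_indep_mod_min S n r v \<longleftrightarrow>
     (\<forall>i<r. v i \<in> sl_max S n) \<and>
     (\<forall>\<alpha>::nat \<Rightarrow> complex. (\<lambda>x. \<Sum>i<r. \<alpha> i * v i x) \<in> sl_min S n \<longrightarrow> (\<forall>i<r. \<alpha> i = 0))"


subsection \<open>Deficiency indices\<close>

global_interpretation cfun: vector_space "\<lambda>(c::complex) (f::real \<Rightarrow> complex) x. c * f x"
  by unfold_locales (auto simp: fun_eq_iff algebra_simps)

text \<open>\<open>cfun.dim\<close> is \<open>0\<close> on infinite-dimensional spaces, hence the explicit finite basis.\<close>

definition has_dim :: "(real \<Rightarrow> complex) set \<Rightarrow> nat \<Rightarrow> bool" where
  "has_dim V d \<longleftrightarrow> (\<exists>B. finite B \<and> card B = d \<and> cfun.independent B \<and> cfun.span B = V)"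

definition defect_space :: "sl_expr \<Rightarrow> nat \<Rightarrow> complex \<Rightarrow> (real \<Rightarrow> complex) set" where
  "defect_space S n z = {f \<in> sl_max S n. ae_eq S (sl_pow S n f) (\<lambda>x. z * f x)}"

definition deficiency_indices :: "sl_expr \<Rightarrow> nat \<Rightarrow> nat \<Rightarrow> nat \<Rightarrow> bool" where
  "deficiency_indices S n d1 d2 \<longleftrightarrow>
     has_dim (defect_space S n \<i>) d1 \<and> has_dim (defect_space S n (- \<i>)) d2"


subsection \<open>Operators in \<open>L\<^sup>2[(a,b),w]\<close>\<close>

text \<open>An operator is given by its action \<open>A\<close> and its domain \<open>D\<close>. \<open>adjoint_graph S A D f h\<close> says that
  \<open>f\<close> lies in the domain of the adjoint, which maps it to \<open>h\<close>; self-adjointness says that the graphs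
  of the operator and of its adjoint agree up to almost-everywhere equality.\<close>

definition adjoint_graph ::
    "sl_expr \<Rightarrow> ((real \<Rightarrow> complex) \<Rightarrow> real \<Rightarrow> complex) \<Rightarrow> (real \<Rightarrow> complex) set
     \<Rightarrow> (real \<Rightarrow> complex) \<Rightarrow> (real \<Rightarrow> complex) \<Rightarrow> bool" where
  "adjoint_graph S A D f h \<longleftrightarrow>
     f \<in> L2 S \<and> h \<in> L2 S \<and> (\<forall>g\<in>D. L2_inner S (A g) f = L2_inner S g h)"

definition dense_in_L2 :: "sl_expr \<Rightarrow> (real \<Rightarrow> complex) set \<Rightarrow> bool" where
  "dense_in_L2 S D \<longleftrightarrow> D \<subseteq> L2 S \<and>
     (\<forall>f\<in>L2 S. \<forall>\<epsilon>>0. \<exists>g\<in>D. Re (L2_inner S (\<lambda>x. f x - g x) (\<lambda>x. f x - g x)) < \<epsilon>\<^sup>2)"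

definition self_adjoint ::
    "sl_expr \<Rightarrow> ((real \<Rightarrow> complex) \<Rightarrow> real \<Rightarrow> complex) \<Rightarrow> (real \<Rightarrow> complex) set \<Rightarrow> bool" where
  "self_adjoint S A D \<longleftrightarrow>
     cfun.subspace D \<and> dense_in_L2 S D \<and>
     (\<forall>f h. adjoint_graph S A D f h \<longleftrightarrow> (\<exists>g\<in>D. ae_eq S f g \<and> ae_eq S h (A g)))"

definition bounded_below_by ::
    "sl_expr \<Rightarrow> ((real \<Rightarrow> complex) \<Rightarrow> real \<Rightarrow> complex) \<Rightarrow> (real \<Rightarrow> complex) set \<Rightarrow> real \<Rightarrow> bool" where
  "bounded_below_by S A D \<kappa> \<longleftrightarrow>
     (\<forall>f\<in>D. Re (L2_inner S (A f) f) \<ge> \<kappa> * Re (L2_inner S f f))"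

definition eigenfunction ::
    "sl_expr \<Rightarrow> ((real \<Rightarrow> complex) \<Rightarrow> real \<Rightarrow> complex) \<Rightarrow> (real \<Rightarrow> complex) set
     \<Rightarrow> (real \<Rightarrow> complex) \<Rightarrow> bool" where
  "eigenfunction S A D f \<longleftrightarrow>
     f \<in> D \<and> \<not> ae_eq S f (\<lambda>x. 0) \<and> (\<exists>z::complex. ae_eq S (A f) (\<lambda>x. z * f x))"

definition complete_orthogonal_system :: "sl_expr \<Rightarrow> (nat \<Rightarrow> real \<Rightarrow> complex) \<Rightarrow> bool" where
  "complete_orthogonal_system S P \<longleftrightarrow>
     (\<forall>k. P k \<in> L2 S \<and> \<not> ae_eq S (P k) (\<lambda>x. 0)) \<and>
     (\<forall>j k. j \<noteq> k \<longrightarrow> L2_inner S (P j) (P k) = 0) \<and>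
     (\<forall>f\<in>L2 S. (\<forall>k. L2_inner S f (P k) = 0) \<longrightarrow> ae_eq S f (\<lambda>x. 0))"

fun op_pow_dom ::
    "sl_expr \<Rightarrow> ((real \<Rightarrow> complex) \<Rightarrow> real \<Rightarrow> complex) \<Rightarrow> (real \<Rightarrow> complex) set \<Rightarrow> nat
     \<Rightarrow> (real \<Rightarrow> complex) set" where
  "op_pow_dom S A D 0 = L2 S"
| "op_pow_dom S A D (Suc n) = {f \<in> D. \<exists>g \<in> op_pow_dom S A D n. ae_eq S (A f) g}"

definition op_shift ::
    "((real \<Rightarrow> complex) \<Rightarrow> real \<Rightarrow> complex) \<Rightarrow> real \<Rightarrow> (real \<Rightarrow> complex) \<Rightarrow> real \<Rightarrow> complex" where
  "op_shift A c f = (\<lambda>x. A f x + of_real c * f x)"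

text \<open>The left-definite space \<open>V\<^sub>r = D(A\<^bsup>r/2\<^esup>)\<close> of even index \<open>r = 2n\<close>, as a vector space, for \<open>A\<close>
  self-adjoint and bounded below by some \<open>\<kappa> > 0\<close>.\<close>

definition left_definite_space_even ::
    "sl_expr \<Rightarrow> ((real \<Rightarrow> complex) \<Rightarrow> real \<Rightarrow> complex) \<Rightarrow> (real \<Rightarrow> complex) set \<Rightarrow> nat
     \<Rightarrow> (real \<Rightarrow> complex) set" where
  "left_definite_space_even S A D n = op_pow_dom S A D n"

end

theory Submission
  imports Defs
begin

text \<open>
Let \<open>L\<close> be the given self-adjoint operator, with real eigenvalues \<open>\<lambda>\<^sub>k\<close>, and let \<open>D(L\<^sup>n)\<close> be the domain
of its \<open>n\<close>th power, the left-definite space in question. Write \<open>[f, g]\<close> for the bracket of order \<open>n\<close>.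

The eigenfunctions diagonalize everything. By Parseval's identity and the Riesz--Fischer theorem, a
square-integrable \<open>f\<close> lies in \<open>D(L\<^sup>n)\<close> and is mapped to \<open>h\<close> as soon as the coefficients of \<open>h\<close> are
\<open>\<lambda>\<^sub>k\<^sup>n\<close> times those of \<open>f\<close> (lemma \<open>ex_pow_dom_if_coeff\<close>). Three facts follow.
First, an \<open>f\<close> in the maximal domain with \<open>[f, P\<^sub>k] = 0\<close> for all \<open>k\<close> lies in \<open>D(L\<^sup>n)\<close>
(\<open>pow_dom_if_bracket_P\<close>), while the bracket vanishes on \<open>D(L\<^sup>n)\<close>. Second, \<open>L\<^sup>n - \<i>\<close> maps \<open>D(L\<^sup>n)\<close> onto
\<open>L\<^sup>2\<close>, so every element of the maximal domain is the sum of an element of \<open>D(L\<^sup>n)\<close> and one of the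
deficiency space for \<open>\<i>\<close> (\<open>sl_max_decompose\<close>). Third, this sum is direct
(\<open>pow_dom_Int_defect_space\<close>).

What remains is finite-dimensional. Let \<open>E\<^sub>1, \<dots>, E\<^sub>N\<close> be a basis of the deficiency space, where
\<open>N = nm\<close>. By the first and third facts, no nontrivial combination of the \<open>E\<^sub>j\<close> is annihilated by all
functionals \<open>[\<cdot>, P\<^sub>k]\<close>, so the matrix \<open>[E\<^sub>j, P\<^sub>k]\<close> with \<open>N\<close> columns and infinitely many rows has \<open>N\<close>
rows forming a nonsingular square matrix (\<open>nonsingular_square_rows\<close>). The corresponding
eigenfunctions are the required ones (\<open>GKN_eigenfunctions\<close>): they are independent modulo the minimal
domain, because no nontrivial combination of them has vanishing brackets with all \<open>E\<^sub>j\<close>; and if an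
element of the maximal domain has vanishing brackets with all of them, then so has its deficiency
component, which is therefore zero, so that the element lies in \<open>D(L\<^sup>n)\<close>. Finally, replacing
\<open>L\<close> by \<open>L + c\<close> does not change the domains of the powers (\<open>op_pow_dom_shift\<close>).

Functions are compared only almost everywhere in \<open>L\<^sup>2\<close>, while the domains are sets of functions. The two
views are reconciled by continuity: two elements of a maximal domain that agree almost everywhere are
equal.\<close>

section \<open>Square-integrable functions\<close>

definition sq_integrable :: "'a measure \<Rightarrow> ('a \<Rightarrow> complex) set" where
  "sq_integrable M = {f \<in> borel_measurable M. integrable M (\<lambda>x. (cmod (f x))\<^sup>2)}"

definition inner_on :: "'a measure \<Rightarrow> ('a \<Rightarrow> complex) \<Rightarrow> ('a \<Rightarrow> complex) \<Rightarrow> complex" where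
  "inner_on M f g = (LINT x|M. f x * cnj (g x))"

definition sq_norm_on :: "'a measure \<Rightarrow> ('a \<Rightarrow> complex) \<Rightarrow> real" where
  "sq_norm_on M f = (LINT x|M. (cmod (f x))\<^sup>2)"

lemma sq_integrable_measurable [measurable_dest]:
  "f \<in> sq_integrable M \<Longrightarrow> f \<in> borel_measurable M"
  by (simp add: sq_integrable_def)

lemma borel_measurable_cnj [measurable (raw)]:
  "f \<in> borel_measurable M \<Longrightarrow> (\<lambda>x. cnj (f x)) \<in> borel_measurable M"
  by (rule borel_measurable_continuous_on[OF continuous_on_cnj[OF continuous_on_id]])

lemma integrable_cmod_mult:
  assumes f: "f \<in> sq_integrable M" and g: "g \<in> sq_integrable M"
  shows "integrable M (\<lambda>x. cmod (f x) * cmod (g x))"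
proof (rule Bochner_Integration.integrable_bound)
  show "integrable M (\<lambda>x. (cmod (f x))\<^sup>2 + (cmod (g x))\<^sup>2)"
    using f g by (auto simp: sq_integrable_def)
  show "(\<lambda>x. cmod (f x) * cmod (g x)) \<in> borel_measurable M"
    using f g by measurable
  have "s * t \<le> s\<^sup>2 + t\<^sup>2" if "s \<ge> 0" "t \<ge> 0" for s t :: real
    using sum_squares_bound[of s t] mult_nonneg_nonneg[OF that] by linarith
  then show "AE x in M. norm (cmod (f x) * cmod (g x)) \<le> norm ((cmod (f x))\<^sup>2 + (cmod (g x))\<^sup>2)"
    by (auto simp: abs_mult)
qed

lemma integrable_mult_cnj:
  assumes f: "f \<in> sq_integrable M" and g: "g \<in> sq_integrable M"
  shows "integrable M (\<lambda>x. f x * cnj (g x))"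
  by (rule Bochner_Integration.integrable_bound[OF integrable_cmod_mult[OF f g]])
     (use f g in \<open>auto simp: norm_mult dest!: sq_integrable_measurable intro!: borel_measurable_times borel_measurable_cnj\<close>)

lemma sq_integrable_add_mult:
  assumes f: "f \<in> sq_integrable M" and g: "g \<in> sq_integrable M"
  shows "(\<lambda>x. f x + a * g x) \<in> sq_integrable M"
proof -
  have "integrable M (\<lambda>x. (cmod (f x + a * g x))\<^sup>2)"
  proof (rule Bochner_Integration.integrable_bound)
    show "integrable M (\<lambda>x. (cmod (f x))\<^sup>2 + (cmod a)\<^sup>2 * (cmod (g x))\<^sup>2
        + 2 * cmod a * (cmod (f x) * cmod (g x)))"
      using f g integrable_cmod_mult[OF f g] by (auto simp: sq_integrable_def)
    show "(\<lambda>x. (cmod (f x + a * g x))\<^sup>2) \<in> borel_measurable M"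
      using f g by measurable
    have "(cmod (z + a * y))\<^sup>2 \<le> (cmod z)\<^sup>2 + (cmod a)\<^sup>2 * (cmod y)\<^sup>2 + 2 * cmod a * (cmod z * cmod y)"
      for z y
    proof -
      have "(cmod (z + a * y))\<^sup>2 \<le> (cmod z + cmod a * cmod y)\<^sup>2"
        using norm_triangle_ineq[of z "a * y"] by (intro power_mono) (auto simp: norm_mult)
      then show ?thesis by (simp add: power2_eq_square algebra_simps)
    qed
    then show "AE x in M. norm ((cmod (f x + a * g x))\<^sup>2) \<le>
        norm ((cmod (f x))\<^sup>2 + (cmod a)\<^sup>2 * (cmod (g x))\<^sup>2 + 2 * cmod a * (cmod (f x) * cmod (g x)))"
      by (auto simp: abs_of_nonneg)
  qed
  then show ?thesis using f g by (auto simp: sq_integrable_def)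
qed

lemma sq_integrable_zero [simp]: "(\<lambda>x. 0) \<in> sq_integrable M"
  by (simp add: sq_integrable_def)

lemma sq_integrable_scale:
  "f \<in> sq_integrable M \<Longrightarrow> (\<lambda>x. a * f x) \<in> sq_integrable M"
  using sq_integrable_add_mult[OF sq_integrable_zero, of f M a] by simp

lemma sq_integrable_diff:
  "f \<in> sq_integrable M \<Longrightarrow> g \<in> sq_integrable M \<Longrightarrow> (\<lambda>x. f x - g x) \<in> sq_integrable M"
  using sq_integrable_add_mult[of f M g "-1"] by simp

lemma sq_integrable_sum:
  assumes "finite K" "\<And>k. k \<in> K \<Longrightarrow> e k \<in> sq_integrable M"
  shows "(\<lambda>x. \<Sum>k\<in>K. c k * e k x) \<in> sq_integrable M"
  using assms
proof (induction K rule: finite_induct)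
  case (insert k K)
  have "(\<lambda>x. (\<Sum>k\<in>K. c k * e k x) + c k * e k x) \<in> sq_integrable M"
    using insert by (intro sq_integrable_add_mult) auto
  then show ?case using insert by (simp add: add.commute)
qed simp

lemma inner_on_self: "inner_on M f f = of_real (sq_norm_on M f)"
  unfolding inner_on_def sq_norm_on_def
  by (simp add: complex_norm_square[symmetric] integral_of_real[symmetric] del: of_real_power)

lemma inner_on_commute: "inner_on M g f = cnj (inner_on M f g)"
  unfolding inner_on_def by (simp add: Bochner_Integration.integral_cnj[symmetric] mult.commute)

lemma inner_on_add_mult_left:
  assumes "f \<in> sq_integrable M" "g \<in> sq_integrable M" "h \<in> sq_integrable M"
  shows "inner_on M (\<lambda>x. f x + a * g x) h = inner_on M f h + a * inner_on M g h"
proof -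
  have "inner_on M (\<lambda>x. f x + a * g x) h
      = (LINT x|M. f x * cnj (h x) + a * (g x * cnj (h x)))"
    unfolding inner_on_def by (simp add: algebra_simps)
  then show ?thesis
    using integrable_mult_cnj[OF assms(1,3)] integrable_mult_cnj[OF assms(2,3)]
    by (simp add: inner_on_def)
qed

lemma inner_on_scale_left: "inner_on M (\<lambda>x. a * f x) h = a * inner_on M f h"
  unfolding inner_on_def by (simp add: mult.assoc)

lemma inner_on_diff_left:
  assumes "f \<in> sq_integrable M" "g \<in> sq_integrable M" "h \<in> sq_integrable M"
  shows "inner_on M (\<lambda>x. f x - g x) h = inner_on M f h - inner_on M g h"
  using inner_on_add_mult_left[OF assms, of "-1"] by simp

lemma inner_on_add_mult_right:
  assumes "f \<in> sq_integrable M" "g \<in> sq_integrable M" "h \<in> sq_integrable M"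
  shows "inner_on M h (\<lambda>x. f x + a * g x) = inner_on M h f + cnj a * inner_on M h g"
  by (subst (1 2 3) inner_on_commute) (simp add: inner_on_add_mult_left assms)

lemma inner_on_diff_right:
  assumes "f \<in> sq_integrable M" "g \<in> sq_integrable M" "h \<in> sq_integrable M"
  shows "inner_on M h (\<lambda>x. f x - g x) = inner_on M h f - inner_on M h g"
  using inner_on_add_mult_right[OF assms, of "-1"] by simp

lemma inner_on_sum_left:
  assumes "finite K" "\<And>k. k \<in> K \<Longrightarrow> e k \<in> sq_integrable M" "h \<in> sq_integrable M"
  shows "inner_on M (\<lambda>x. \<Sum>k\<in>K. c k * e k x) h = (\<Sum>k\<in>K. c k * inner_on M (e k) h)"
  using assms(1,2)
proof (induction K rule: finite_induct)
  case empty
  show ?case by (simp add: inner_on_def)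
next
  case (insert k K)
  have "inner_on M (\<lambda>x. (\<Sum>k\<in>K. c k * e k x) + c k * e k x) h
      = (\<Sum>k\<in>K. c k * inner_on M (e k) h) + c k * inner_on M (e k) h"
    using insert assms(3) by (subst inner_on_add_mult_left) (auto intro: sq_integrable_sum)
  then show ?case using insert by (simp add: add.commute)
qed

lemma sq_norm_on_nonneg: "0 \<le> sq_norm_on M f"
  by (simp add: sq_norm_on_def)

lemma sq_norm_on_eq_0_iff:
  assumes "f \<in> sq_integrable M"
  shows "sq_norm_on M f = 0 \<longleftrightarrow> (AE x in M. f x = 0)"
  using assms unfolding sq_norm_on_def
  by (subst integral_nonneg_eq_0_iff_AE) (auto simp: sq_integrable_def)

lemma nn_integral_sq_norm:
  assumes "f \<in> sq_integrable M"
  shows "(\<integral>\<^sup>+x. ennreal ((cmod (f x))\<^sup>2) \<partial>M) = ennreal (sq_norm_on M f)"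
  using assms unfolding sq_norm_on_def
  by (intro nn_integral_eq_integral) (auto simp: sq_integrable_def)

lemma sq_norm_on_diff_commute: "sq_norm_on M (\<lambda>x. f x - g x) = sq_norm_on M (\<lambda>x. g x - f x)"
  unfolding sq_norm_on_def by (simp add: norm_minus_commute)

lemma Cauchy_Schwarz_inner_on:
  assumes f: "f \<in> sq_integrable M" and g: "g \<in> sq_integrable M"
  shows "(cmod (inner_on M f g))\<^sup>2 \<le> sq_norm_on M f * sq_norm_on M g"
proof -
  have "cmod (inner_on M f g) \<le> (LINT x|M. cmod (f x) * cmod (g x))" (is "_ \<le> ?I")
    unfolding inner_on_def using integral_norm_bound[of M "\<lambda>x. f x * cnj (g x)"]
    by (simp add: norm_mult)
  then have "ennreal ((cmod (inner_on M f g))\<^sup>2) \<le> ennreal (?I\<^sup>2)"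
    by (intro ennreal_leI power_mono) auto
  also have "ennreal (?I\<^sup>2) = (\<integral>\<^sup>+x. ennreal (cmod (f x)) * ennreal (cmod (g x)) \<partial>M)\<^sup>2"
    using integrable_cmod_mult[OF f g]
    by (simp add: ennreal_power[symmetric] ennreal_mult[symmetric] nn_integral_eq_integral)
  also have "\<dots> \<le> (\<integral>\<^sup>+x. (ennreal (cmod (f x)))\<^sup>2 \<partial>M) * (\<integral>\<^sup>+x. (ennreal (cmod (g x)))\<^sup>2 \<partial>M)"
    using f g by (intro Cauchy_Schwarz_nn_integral) (auto dest!: sq_integrable_measurable)
  also have "\<dots> = ennreal (sq_norm_on M f * sq_norm_on M g)"
    by (simp add: ennreal_power nn_integral_sq_norm f g ennreal_mult sq_norm_on_nonneg)
  finally show ?thesis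
    by (subst (asm) ennreal_le_iff) (auto simp: sq_norm_on_nonneg)
qed

text \<open>Along a subsequence whose consecutive differences \<open>d j\<close> have square norm at most \<open>(1/8)^j\<close>, the
  sum of the \<open>2^j * \<bar>d j\<bar>\<^sup>2\<close> has finite integral, hence is finite almost everywhere. As
  \<open>\<bar>d j\<bar> \<le> 2^j * \<bar>d j\<bar>\<^sup>2 + (1/2)^j\<close>, the differences are then absolutely summable almost everywhere. Fatou's lemma carries the Cauchy estimate over
  to the pointwise limit.\<close>

lemma sq_integrable_complete:
  assumes u: "\<And>n. u n \<in> sq_integrable M"
    and Cauchy: "\<And>\<epsilon>. \<epsilon> > 0 \<Longrightarrow> \<exists>N. \<forall>m\<ge>N. \<forall>n\<ge>N. sq_norm_on M (\<lambda>x. u m x - u n x) < \<epsilon>"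
  obtains g where "g \<in> sq_integrable M" "(\<lambda>n. sq_norm_on M (\<lambda>x. u n x - g x)) \<longlonglongrightarrow> 0"
proof -
  have [measurable]: "u n \<in> borel_measurable M" for n
    using u[of n] by measurable
  have diff: "(\<lambda>x. u m x - u n x) \<in> sq_integrable M" for m n
    by (intro sq_integrable_diff u)
  have "\<forall>j. \<exists>N. \<forall>m\<ge>N. \<forall>n\<ge>N. sq_norm_on M (\<lambda>x. u m x - u n x) < (1/8)^j"
    by (intro allI Cauchy) auto
  then obtain N where N: "\<And>j m n. m \<ge> N j \<Longrightarrow> n \<ge> N j \<Longrightarrow> sq_norm_on M (\<lambda>x. u m x - u n x) < (1/8)^j"
    by metis
  define r where "r j = Max (N ` {..j}) + j" for j
  have r_ge: "r j \<ge> N i" if "i \<le> j" for i j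
  proof -
    have "N i \<le> Max (N ` {..j})" using that by (intro Max_ge) auto
    then show ?thesis by (simp add: r_def)
  qed
  have r_ge_self: "r j \<ge> j" for j by (simp add: r_def)
  define d where "d j x = u (r (Suc j)) x - u (r j) x" for j x
  have d_bound: "sq_norm_on M (d j) \<le> (1/8)^j" for j
    using N[of j "r (Suc j)" "r j"] r_ge[of j j] r_ge[of j "Suc j"] by (simp add: d_def[abs_def] less_imp_le)
  have d_sq: "d j \<in> sq_integrable M" for j
    using diff by (simp add: d_def[abs_def])
  have [measurable]: "d j \<in> borel_measurable M" for j
    using d_sq[of j] by measurable
  have "(\<integral>\<^sup>+x. (\<Sum>j. ennreal (2^j * (cmod (d j x))\<^sup>2)) \<partial>M)
      = (\<Sum>j. \<integral>\<^sup>+x. ennreal (2^j * (cmod (d j x))\<^sup>2) \<partial>M)"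
    by (intro nn_integral_suminf) auto
  also have "\<dots> = (\<Sum>j. ennreal (2^j * sq_norm_on M (d j)))"
  proof (rule arg_cong[where f = suminf], rule ext)
    fix j
    have "(\<integral>\<^sup>+x. ennreal (2^j * (cmod (d j x))\<^sup>2) \<partial>M)
        = (\<integral>\<^sup>+x. ennreal (2^j) * ennreal ((cmod (d j x))\<^sup>2) \<partial>M)"
      by (intro nn_integral_cong ennreal_mult) auto
    also have "\<dots> = ennreal (2^j) * (\<integral>\<^sup>+x. ennreal ((cmod (d j x))\<^sup>2) \<partial>M)"
      by (intro nn_integral_cmult) measurable
    also have "\<dots> = ennreal (2^j) * ennreal (sq_norm_on M (d j))"
      by (simp only: nn_integral_sq_norm[OF d_sq])
    also have "\<dots> = ennreal (2^j * sq_norm_on M (d j))"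
      by (rule ennreal_mult[symmetric]) (auto simp: sq_norm_on_nonneg)
    finally show "(\<integral>\<^sup>+x. ennreal (2^j * (cmod (d j x))\<^sup>2) \<partial>M) = \<dots>" .
  qed
  also have "\<dots> \<le> (\<Sum>j. ennreal ((1/4)^j))"
  proof (intro suminf_le ennreal_leI)
    fix j :: nat
    have "2^j * sq_norm_on M (d j) \<le> 2^j * (1/8)^j"
      by (intro mult_left_mono d_bound) auto
    also have "2^j * (1/8)^j = (1/4 :: real)^j"
      by (subst power_mult_distrib[symmetric]) simp
    finally show "2^j * sq_norm_on M (d j) \<le> (1/4)^j" .
  qed auto
  also have "\<dots> < \<infinity>"
  proof -
    have "summable (\<lambda>j. (1/4::real)^j)" by (rule summable_geometric) auto
    then have "(\<Sum>j. ennreal ((1/4)^j)) \<noteq> top" by (rule ennreal_suminf_neq_top) auto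
    then show ?thesis by (simp only: infinity_ennreal_def less_top[symmetric] not_False_eq_True)
  qed
  finally have "(\<integral>\<^sup>+x. (\<Sum>j. ennreal (2^j * (cmod (d j x))\<^sup>2)) \<partial>M) \<noteq> \<infinity>"
    by simp
  then have "AE x in M. (\<Sum>j. ennreal (2^j * (cmod (d j x))\<^sup>2)) \<noteq> \<infinity>"
    by (intro nn_integral_PInf_AE) auto
  then have AE_conv: "AE x in M. convergent (\<lambda>k. u (r k) x)"
  proof eventually_elim
    case (elim x)
    have "summable (\<lambda>j. 2^j * (cmod (d j x))\<^sup>2)"
      using elim by (intro summable_suminf_not_top) auto
    then have "summable (\<lambda>j. 2^j * (cmod (d j x))\<^sup>2 + (1/2)^j)"
      by (intro summable_add) auto
    then have "summable (\<lambda>j. d j x)"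
    proof (rule summable_comparison_test')
      fix j :: nat
      define t where "t = cmod (d j x)"
      \<comment> \<open>the weight \<open>2^j\<close> turns summable squares into summable absolute values\<close>
      have "0 \<le> (2^j * t - 1)\<^sup>2 / 2^j" by simp
      also have "\<dots> = 2^j * t\<^sup>2 + (1/2)^j - 2 * t"
        by (simp add: field_simps power2_eq_square)
      finally have "2 * t \<le> 2^j * t\<^sup>2 + (1/2)^j" by simp
      moreover have "t \<ge> 0" by (simp add: t_def)
      ultimately have "t \<le> 2^j * t\<^sup>2 + (1/2)^j" by linarith
      then show "norm (d j x) \<le> 2^j * (cmod (d j x))\<^sup>2 + (1/2)^j"
        by (simp only: t_def)
    qed
    then have "convergent (\<lambda>k. u (r 0) x + (\<Sum>j<k. d j x))"
      by (intro convergent_add convergent_const) (simp add: summable_iff_convergent)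
    moreover have "u (r 0) x + (\<Sum>j<k. d j x) = u (r k) x" for k
      using sum_lessThan_telescope[of "\<lambda>j. u (r j) x" k] by (simp add: d_def)
    ultimately show ?case by simp
  qed
  define g where "g x = lim (\<lambda>k. u (r k) x)" for x
  have [measurable]: "g \<in> borel_measurable M"
    unfolding g_def by measurable
  have AE_lim: "AE x in M. (\<lambda>k. u (r k) x) \<longlonglongrightarrow> g x"
    using AE_conv by eventually_elim (simp add: g_def convergent_LIMSEQ_iff)
  have bound: "(\<integral>\<^sup>+x. ennreal ((cmod (u n x - g x))\<^sup>2) \<partial>M) \<le> ennreal \<epsilon>"
    if n: "\<And>m. m \<ge> N0 \<Longrightarrow> sq_norm_on M (\<lambda>x. u n x - u m x) < \<epsilon>" for n N0 \<epsilon>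
  proof -
    have "(\<integral>\<^sup>+x. ennreal ((cmod (u n x - g x))\<^sup>2) \<partial>M)
        = (\<integral>\<^sup>+x. liminf (\<lambda>k. ennreal ((cmod (u n x - u (r k) x))\<^sup>2)) \<partial>M)"
    proof (rule nn_integral_cong_AE, use AE_lim in eventually_elim)
      case (elim x)
      then have "(\<lambda>k. ennreal ((cmod (u n x - u (r k) x))\<^sup>2)) \<longlonglongrightarrow> ennreal ((cmod (u n x - g x))\<^sup>2)"
        by (intro tendsto_intros)
      then show ?case
        by (rule lim_imp_Liminf[OF sequentially_bot, symmetric])
    qed
    also have "\<dots> \<le> liminf (\<lambda>k. \<integral>\<^sup>+x. ennreal ((cmod (u n x - u (r k) x))\<^sup>2) \<partial>M)"
      by (intro nn_integral_liminf) measurable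
    also have "\<dots> = liminf (\<lambda>k. ennreal (sq_norm_on M (\<lambda>x. u n x - u (r k) x)))"
      by (simp add: nn_integral_sq_norm diff)
    also have "\<dots> \<le> ennreal \<epsilon>"
    proof (rule order_trans[OF Liminf_le_Limsup Limsup_bounded])
      show "\<forall>\<^sub>F k in sequentially. ennreal (sq_norm_on M (\<lambda>x. u n x - u (r k) x)) \<le> ennreal \<epsilon>"
        using eventually_ge_at_top[of N0]
      proof eventually_elim
        case (elim k)
        then have "r k \<ge> N0" using r_ge_self[of k] by simp
        then show ?case using n[of "r k"] by (intro ennreal_leI) simp
      qed
    qed simp
    finally show ?thesis .
  qed
  have sq: "(\<lambda>x. u n x - g x) \<in> sq_integrable M" if "n \<ge> N 0" for n
  proof -
    have "(\<integral>\<^sup>+x. ennreal ((cmod (u n x - g x))\<^sup>2) \<partial>M) \<le> ennreal 1"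
      by (rule bound[of "N 0"]) (use N[of 0 n] that in auto)
    also have "\<dots> < \<infinity>" by simp
    finally have "integrable M (\<lambda>x. (cmod (u n x - g x))\<^sup>2)"
      by (intro integrableI_bounded) auto
    moreover have "(\<lambda>x. u n x - g x) \<in> borel_measurable M" by measurable
    ultimately show ?thesis unfolding sq_integrable_def by blast
  qed
  show thesis
  proof (rule that)
    show "g \<in> sq_integrable M"
      using sq_integrable_diff[OF u[of "N 0"] sq[of "N 0"]] by simp
    show "(\<lambda>n. sq_norm_on M (\<lambda>x. u n x - g x)) \<longlonglongrightarrow> 0"
    proof (rule LIMSEQ_I)
      fix e :: real assume "e > 0"
      then obtain K where K: "\<And>m n. m \<ge> K \<Longrightarrow> n \<ge> K \<Longrightarrow> sq_norm_on M (\<lambda>x. u m x - u n x) < e/2"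
        using Cauchy[of "e/2"] by auto
      show "\<exists>no. \<forall>n\<ge>no. norm (sq_norm_on M (\<lambda>x. u n x - g x) - 0) < e"
      proof (intro exI allI impI)
        fix n assume n: "n \<ge> max K (N 0)"
        have "ennreal (sq_norm_on M (\<lambda>x. u n x - g x)) \<le> ennreal (e/2)"
          using bound[of K n "e/2"] K[of n] sq[of n] n by (simp add: nn_integral_sq_norm)
        then have "sq_norm_on M (\<lambda>x. u n x - g x) \<le> e/2"
          using \<open>e > 0\<close> by (subst (asm) ennreal_le_iff) auto
        then show "norm (sq_norm_on M (\<lambda>x. u n x - g x) - 0) < e"
          using \<open>e > 0\<close> sq_norm_on_nonneg[of M "\<lambda>x. u n x - g x"] by simp
      qed
    qed
  qed
qed

lemma inner_on_tendsto:
  assumes u: "\<And>n. u n \<in> sq_integrable M" and g: "g \<in> sq_integrable M" and h: "h \<in> sq_integrable M"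
    and lim: "(\<lambda>n. sq_norm_on M (\<lambda>x. u n x - g x)) \<longlonglongrightarrow> 0"
  shows "(\<lambda>n. inner_on M (u n) h) \<longlonglongrightarrow> inner_on M g h"
proof -
  have "(\<lambda>n. sqrt (sq_norm_on M (\<lambda>x. u n x - g x) * sq_norm_on M h)) \<longlonglongrightarrow> sqrt (0 * sq_norm_on M h)"
    by (intro tendsto_intros lim)
  then have "(\<lambda>n. inner_on M (u n) h - inner_on M g h) \<longlonglongrightarrow> 0"
  proof (rule Lim_null_comparison[rotated, OF tendsto_eq_rhs])
    show "\<forall>\<^sub>F n in sequentially. cmod (inner_on M (u n) h - inner_on M g h)
        \<le> sqrt (sq_norm_on M (\<lambda>x. u n x - g x) * sq_norm_on M h)"
      using Cauchy_Schwarz_inner_on[OF sq_integrable_diff[OF u g] h]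
      by (intro always_eventually allI real_le_rsqrt) (simp add: inner_on_diff_left u g h)
  qed simp
  then show ?thesis by (simp add: LIM_zero_iff)
qed

section \<open>Orthonormal bases\<close>

text \<open>Completeness is required only in the weak form that no nonzero function is orthogonal to the system;
  since the space is complete, convergence of the expansions follows.\<close>

locale orthonormal_basis_on =
  fixes M :: "'a measure" and e :: "nat \<Rightarrow> 'a \<Rightarrow> complex"
  assumes e_sq: "\<And>k. e k \<in> sq_integrable M"
    and orthonormal: "\<And>j k. inner_on M (e j) (e k) = (if j = k then 1 else 0)"
    and complete: "\<And>f. f \<in> sq_integrable M \<Longrightarrow> (\<And>k. inner_on M f (e k) = 0) \<Longrightarrow> AE x in M. f x = 0"
begin

abbreviation coeff :: "('a \<Rightarrow> complex) \<Rightarrow> nat \<Rightarrow> complex" where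
  "coeff f k \<equiv> inner_on M f (e k)"

lemma coeff_combination:
  "finite K \<Longrightarrow> coeff (\<lambda>x. \<Sum>k\<in>K. c k * e k x) j = (if j \<in> K then c j else 0)"
  by (simp add: inner_on_sum_left e_sq orthonormal if_distrib cong: if_cong)

lemma sq_norm_combination:
  assumes "finite K"
  shows "sq_norm_on M (\<lambda>x. \<Sum>k\<in>K. c k * e k x) = (\<Sum>k\<in>K. (cmod (c k))\<^sup>2)"
proof -
  let ?s = "\<lambda>x. \<Sum>k\<in>K. c k * e k x"
  have s: "?s \<in> sq_integrable M" using assms e_sq by (rule sq_integrable_sum)
  have "inner_on M ?s ?s = (\<Sum>k\<in>K. c k * cnj (coeff ?s k))"
    using assms s e_sq by (subst inner_on_sum_left) (auto simp flip: inner_on_commute)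
  also have "\<dots> = (\<Sum>k\<in>K. c k * cnj (c k))"
    by (intro sum.cong refl) (simp add: coeff_combination assms)
  also have "\<dots> = of_real (\<Sum>k\<in>K. (cmod (c k))\<^sup>2)"
    by (simp add: complex_norm_square del: of_real_power)
  finally show ?thesis by (simp add: inner_on_self flip: of_real_sum)
qed

text \<open>The square norm of \<open>f\<close> minus a partial sum of its expansion is the square norm of \<open>f\<close> minus the
  partial sum of the squared coefficients, and it is nonnegative.\<close>

lemma bessel:
  assumes "f \<in> sq_integrable M"
  shows "summable (\<lambda>k. (cmod (coeff f k))\<^sup>2)"
proof (rule summableI_nonneg_bounded[where x = "sq_norm_on M f"])
  fix n
  let ?s = "\<lambda>x. \<Sum>k<n. coeff f k * e k x"
  have s: "?s \<in> sq_integrable M" using e_sq by (intro sq_integrable_sum) auto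
  have ss: "inner_on M ?s ?s = (\<Sum>k<n. of_real ((cmod (coeff f k))\<^sup>2))"
    by (simp add: inner_on_self sq_norm_combination)
  have sf: "inner_on M ?s f = (\<Sum>k<n. of_real ((cmod (coeff f k))\<^sup>2))"
    using assms e_sq
    by (subst inner_on_sum_left) (auto simp: complex_norm_square inner_on_commute[of M "e _"]
        simp del: of_real_power intro!: sum.cong)
  have fs: "inner_on M f ?s = (\<Sum>k<n. of_real ((cmod (coeff f k))\<^sup>2))"
    by (subst inner_on_commute) (simp add: sf)
  have "complex_of_real (sq_norm_on M (\<lambda>x. f x - ?s x))
      = of_real (sq_norm_on M f - (\<Sum>k<n. (cmod (coeff f k))\<^sup>2))"
    by (simp add: inner_on_self[symmetric] inner_on_diff_left inner_on_diff_right assms s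
        sq_integrable_diff ss sf fs)
  then have "sq_norm_on M (\<lambda>x. f x - ?s x) = sq_norm_on M f - (\<Sum>k<n. (cmod (coeff f k))\<^sup>2)"
    using of_real_eq_iff by blast
  then show "(\<Sum>k<n. (cmod (coeff f k))\<^sup>2) \<le> sq_norm_on M f"
    using sq_norm_on_nonneg[of M "\<lambda>x. f x - ?s x"] by simp
qed simp

lemma riesz_fischer:
  assumes "summable (\<lambda>k. (cmod (c k))\<^sup>2)"
  shows "\<exists>g \<in> sq_integrable M. (\<forall>k. coeff g k = c k) \<and>
    (\<lambda>n. sq_norm_on M (\<lambda>x. (\<Sum>k<n. c k * e k x) - g x)) \<longlonglongrightarrow> 0"
proof -
  let ?u = "\<lambda>n x. \<Sum>k<n. c k * e k x"
  have u: "?u n \<in> sq_integrable M" for n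
    using e_sq by (intro sq_integrable_sum) auto
  have diff: "sq_norm_on M (\<lambda>x. ?u m x - ?u n x) = (\<Sum>k=n..<m. (cmod (c k))\<^sup>2)" if "n \<le> m" for m n
  proof -
    have "?u m x - ?u n x = (\<Sum>k=n..<m. c k * e k x)" for x
      using sum_diff_nat_ivl[of 0 n m "\<lambda>k. c k * e k x"] that by (simp add: atLeast0LessThan)
    then show ?thesis by (simp add: sq_norm_combination)
  qed
  have Cauchy: "\<exists>N. \<forall>m\<ge>N. \<forall>n\<ge>N. sq_norm_on M (\<lambda>x. ?u m x - ?u n x) < \<epsilon>" if eps: "\<epsilon> > 0" for \<epsilon>
  proof -
    obtain N where N: "\<And>m n. m \<ge> N \<Longrightarrow> norm (\<Sum>k=m..<n. (cmod (c k))\<^sup>2) < \<epsilon>"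
      using assms eps unfolding summable_Cauchy by blast
    have "sq_norm_on M (\<lambda>x. ?u m x - ?u n x) < \<epsilon>" if "m \<ge> N" "n \<ge> N" for m n
    proof (cases "n \<le> m")
      case True
      then show ?thesis using N[of n m] that diff[of n m] by simp
    next
      case False
      then show ?thesis using N[of m n] that diff[of m n] sq_norm_on_diff_commute[of M "?u m" "?u n"] by simp
    qed
    then show ?thesis by blast
  qed
  obtain g where g: "g \<in> sq_integrable M" and lim: "(\<lambda>n. sq_norm_on M (\<lambda>x. ?u n x - g x)) \<longlonglongrightarrow> 0"
    using sq_integrable_complete[of ?u M, OF u Cauchy] by blast
  have "coeff g k = c k" for k
  proof (rule LIMSEQ_unique)
    show "(\<lambda>n. coeff (?u n) k) \<longlonglongrightarrow> coeff g k"
      by (rule inner_on_tendsto[OF u g e_sq lim])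
    have "\<forall>\<^sub>F n in sequentially. coeff (?u n) k = c k"
      using eventually_gt_at_top[of k] by eventually_elim (simp add: coeff_combination)
    then show "(\<lambda>n. coeff (?u n) k) \<longlonglongrightarrow> c k"
      by (rule tendsto_eventually)
  qed
  with g lim show ?thesis by blast
qed

lemma coeff_eq_imp_AE_eq:
  assumes "f \<in> sq_integrable M" "g \<in> sq_integrable M" "\<And>k. coeff f k = coeff g k"
  shows "AE x in M. f x = g x"
proof -
  have "AE x in M. f x - g x = 0"
    using assms by (intro complete sq_integrable_diff) (auto simp: inner_on_diff_left e_sq)
  then show ?thesis by simp
qed

text \<open>The Riesz--Fischer function with the coefficients of \<open>f\<close> has the same coefficients as \<open>f\<close>, so it
  equals \<open>f\<close> almost everywhere; hence the partial sums converge to \<open>f\<close> itself and the inner product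
  may be taken termwise.\<close>

lemma parseval:
  assumes f: "f \<in> sq_integrable M" and h: "h \<in> sq_integrable M"
  shows "(\<lambda>k. coeff f k * cnj (coeff h k)) sums inner_on M f h"
proof -
  obtain g where g: "g \<in> sq_integrable M" "\<And>k. coeff g k = coeff f k"
    and lim: "(\<lambda>n. sq_norm_on M (\<lambda>x. (\<Sum>k<n. coeff f k * e k x) - g x)) \<longlonglongrightarrow> 0"
    using riesz_fischer[OF bessel[OF f]] by blast
  have AE: "AE x in M. g x = f x"
    using g f by (intro coeff_eq_imp_AE_eq) auto
  have "inner_on M g h = inner_on M f h"
    unfolding inner_on_def using AE f g(1) h by (intro integral_cong_AE) auto
  moreover have "(\<lambda>n. inner_on M (\<lambda>x. \<Sum>k<n. coeff f k * e k x) h) \<longlonglongrightarrow> inner_on M g h"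
    by (rule inner_on_tendsto[OF _ g(1) h lim]) (use e_sq in \<open>auto intro: sq_integrable_sum\<close>)
  moreover have "inner_on M (\<lambda>x. \<Sum>k<n. coeff f k * e k x) h = (\<Sum>k<n. coeff f k * cnj (coeff h k))" for n
    using e_sq h by (subst inner_on_sum_left) (auto simp flip: inner_on_commute)
  ultimately show ?thesis by (simp add: sums_def)
qed

end

section \<open>The weighted space as an unweighted one\<close>

text \<open>Putting the weight into the measure makes the weighted \<open>L\<^sup>2\<close> space an ordinary one. Since \<open>w > 0\<close>
  almost everywhere, no null sets are added.\<close>

definition sl_measure :: "sl_expr \<Rightarrow> real measure" where
  "sl_measure S = density (restrict_space lebesgue (sl_ivl S)) (\<lambda>x. ennreal (weight S x))"

lemma open_sl_ivl: "open (sl_ivl S)"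
  by (simp add: sl_ivl_def)

lemma sets_sl_ivl [simp]: "sl_ivl S \<in> sets lebesgue"
  using open_sl_ivl by (metis borel_open sets_completionI_sets sets_lborel)

lemma sl_ivl_nbhd:
  assumes "x \<in> sl_ivl S"
  obtains \<delta> where "\<delta> > 0" "{x - \<delta>..x + \<delta>} \<subseteq> sl_ivl S"
proof -
  obtain \<delta> where "\<delta> > 0" "cball x \<delta> \<subseteq> sl_ivl S"
    using open_contains_cball open_sl_ivl assms by metis
  then show thesis using that by (simp add: cball_eq_atLeastAtMost)
qed

text \<open>The interval is a countable union of compact intervals with rational end points, on each of which
  the function is integrable.\<close>

lemma loc_integrable_measurable:
  assumes "loc_integrable (sl_ivl S) h"
  shows "h \<in> borel_measurable (restrict_space lebesgue (sl_ivl S))"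
proof (rule measurable_piecewise_restrict)
  let ?C = "(\<lambda>(c, d). {c..d}) ` {(c, d). c \<in> \<rat> \<and> d \<in> \<rat> \<and> {c..d} \<subseteq> sl_ivl S}"
  show "countable ?C"
  proof (rule countable_image)
    have "countable (\<rat> \<times> \<rat> :: (real \<times> real) set)"
      by (intro countable_SIGMA countable_rat)
    then show "countable {(c, d :: real). c \<in> \<rat> \<and> d \<in> \<rat> \<and> {c..d} \<subseteq> sl_ivl S}"
      by (rule countable_subset[rotated]) auto
  qed
  show "\<Omega> \<inter> space (restrict_space lebesgue (sl_ivl S)) \<in> sets (restrict_space lebesgue (sl_ivl S))"
    if "\<Omega> \<in> ?C" for \<Omega>
    using that by (auto simp: sets_restrict_space space_restrict_space Int_commute)
  show "space (restrict_space lebesgue (sl_ivl S)) \<subseteq> \<Union> ?C"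
  proof
    fix x assume "x \<in> space (restrict_space lebesgue (sl_ivl S))"
    then have "x \<in> sl_ivl S" by (simp add: space_restrict_space)
    then obtain \<delta> where \<delta>: "\<delta> > 0" "{x - \<delta>..x + \<delta>} \<subseteq> sl_ivl S"
      by (rule sl_ivl_nbhd)
    obtain c where c: "c \<in> \<rat>" "x - \<delta> < c" "c < x"
      using Rats_dense_in_real[of "x - \<delta>" x] \<delta>(1) by auto
    obtain d where d: "d \<in> \<rat>" "x < d" "d < x + \<delta>"
      using Rats_dense_in_real[of x "x + \<delta>"] \<delta>(1) by auto
    have "{c..d} \<subseteq> sl_ivl S"
      using c d by (intro order_trans[OF _ \<delta>(2)]) auto
    then show "x \<in> \<Union> ?C"
      using c d by (intro UnionI[of "{c..d}"]) auto
  qed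
  fix \<Omega> assume "\<Omega> \<in> ?C"
  then obtain c d where \<Omega>: "\<Omega> = {c..d}" "{c..d} \<subseteq> sl_ivl S" by auto
  have "set_integrable lebesgue {c..d} h"
    using assms \<Omega>(2) by (simp add: loc_integrable_def)
  then have "(\<lambda>x. indicator {c..d} x *\<^sub>R h x) \<in> borel_measurable lebesgue"
    unfolding set_integrable_def by (rule borel_measurable_integrable)
  then have "h \<in> borel_measurable (restrict_space lebesgue {c..d})"
    by (subst borel_measurable_restrict_space_iff) auto
  moreover have "restrict_space (restrict_space lebesgue (sl_ivl S)) \<Omega> = restrict_space lebesgue {c..d}"
    using \<Omega> by (subst restrict_restrict_space) (auto simp: Int_absorb1)
  ultimately show "h \<in> borel_measurable (restrict_space (restrict_space lebesgue (sl_ivl S)) \<Omega>)"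
    by simp
qed

lemma weight_measurable:
  "sturm_liouville S \<Longrightarrow> weight S \<in> borel_measurable (restrict_space lebesgue (sl_ivl S))"
  by (intro loc_integrable_measurable) (simp add: sturm_liouville_def)

lemma AE_weight_pos:
  "sturm_liouville S \<Longrightarrow> AE x in restrict_space lebesgue (sl_ivl S). weight S x > 0"
  by (subst AE_restrict_space_iff) (auto simp: sturm_liouville_def)

lemma ae_eq_iff_sl_measure:
  assumes "sturm_liouville S"
  shows "ae_eq S f g \<longleftrightarrow> (AE x in sl_measure S. f x = g x)"
proof -
  have "(AE x in sl_measure S. f x = g x) \<longleftrightarrow>
      (AE x in restrict_space lebesgue (sl_ivl S). 0 < weight S x \<longrightarrow> f x = g x)"
    unfolding sl_measure_def
    by (subst AE_density) (use weight_measurable[OF assms] in \<open>auto\<close>)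
  also have "\<dots> \<longleftrightarrow> (AE x in restrict_space lebesgue (sl_ivl S). f x = g x)"
    using AE_weight_pos[OF assms] by (auto elim: eventually_elim2 eventually_mono)
  also have "\<dots> \<longleftrightarrow> ae_eq S f g"
    by (subst AE_restrict_space_iff) (auto simp: ae_eq_def)
  finally show ?thesis by simp
qed

lemma measurable_sl_measure:
  fixes f :: "real \<Rightarrow> complex"
  shows "f \<in> borel_measurable (sl_measure S) \<longleftrightarrow> set_borel_measurable lebesgue (sl_ivl S) f"
  unfolding sl_measure_def set_borel_measurable_def
  by (simp add: borel_measurable_restrict_space_iff cong: measurable_cong_sets)

lemma L2_eq_sq_integrable:
  assumes "sturm_liouville S"
  shows "L2 S = sq_integrable (sl_measure S)"
proof -
  have "integrable (sl_measure S) (\<lambda>x. (cmod (f x))\<^sup>2) \<longleftrightarrow>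
      set_integrable lebesgue (sl_ivl S) (\<lambda>x. (cmod (f x))\<^sup>2 * weight S x)"
    if "f \<in> borel_measurable (sl_measure S)" for f
  proof -
    have f: "(\<lambda>x. (cmod (f x))\<^sup>2) \<in> borel_measurable (restrict_space lebesgue (sl_ivl S))"
      using that by (simp add: sl_measure_def)
    have "integrable (sl_measure S) (\<lambda>x. (cmod (f x))\<^sup>2) \<longleftrightarrow>
      integrable (restrict_space lebesgue (sl_ivl S)) (\<lambda>x. weight S x *\<^sub>R (cmod (f x))\<^sup>2)"
      unfolding sl_measure_def
      using AE_weight_pos[OF assms]
      by (intro integrable_density f weight_measurable[OF assms]) (auto elim: eventually_mono)
    then show ?thesis
      by (simp add: integrable_restrict_space set_integrable_def mult.commute)
  qed
  then show ?thesis
    by (auto simp: L2_def sq_integrable_def measurable_sl_measure)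
qed

lemma integral_sl_measure:
  assumes "sturm_liouville S" "h \<in> borel_measurable (sl_measure S)"
  shows "(LINT x|sl_measure S. h x) = (CLINT x:sl_ivl S|lebesgue. h x * of_real (weight S x))"
proof -
  have h: "h \<in> borel_measurable (restrict_space lebesgue (sl_ivl S))"
    using assms(2) by (simp add: sl_measure_def)
  have "(LINT x|sl_measure S. h x) = (LINT x|restrict_space lebesgue (sl_ivl S). weight S x *\<^sub>R h x)"
    unfolding sl_measure_def using AE_weight_pos[OF assms(1)]
    by (intro integral_density h weight_measurable[OF assms(1)]) (auto elim: eventually_mono)
  also have "\<dots> = (CLINT x:sl_ivl S|lebesgue. h x * of_real (weight S x))"
    by (subst integral_restrict_space) (auto simp: set_lebesgue_integral_def scaleR_conv_of_real mult_ac)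
  finally show ?thesis .
qed

lemma L2_inner_eq_inner_on:
  assumes S: "sturm_liouville S" and f: "f \<in> L2 S" and g: "g \<in> L2 S"
  shows "L2_inner S f g = inner_on (sl_measure S) f g"
proof -
  have [measurable]: "f \<in> borel_measurable (sl_measure S)" "g \<in> borel_measurable (sl_measure S)"
    using f g by (auto simp: L2_eq_sq_integrable S sq_integrable_def)
  have "(\<lambda>x. f x * cnj (g x)) \<in> borel_measurable (sl_measure S)"
    by measurable
  from integral_sl_measure[OF S this] show ?thesis
    by (simp add: L2_inner_def inner_on_def)
qed


lemma ae_eq_refl [simp]: "ae_eq S f f"
  by (simp add: ae_eq_def)

lemma ae_eq_sym: "ae_eq S f g \<Longrightarrow> ae_eq S g f"
  by (simp add: ae_eq_def eq_commute)

lemma ae_eq_trans [trans]: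
  assumes "ae_eq S f g" "ae_eq S g h"
  shows "ae_eq S f h"
  using assms unfolding ae_eq_def by eventually_elim auto

lemma ae_eq_add_mult:
  assumes "ae_eq S f f'" "ae_eq S g g'"
  shows "ae_eq S (\<lambda>x. f x + a * g x) (\<lambda>x. f' x + a * g' x)"
  using assms unfolding ae_eq_def by eventually_elim auto

lemma ae_eq_cnj: "ae_eq S f g \<Longrightarrow> ae_eq S (\<lambda>x. cnj (f x)) (\<lambda>x. cnj (g x))"
  unfolding ae_eq_def by (erule eventually_mono) auto

text \<open>Measurability passes to \<open>g\<close> because Lebesgue measure is complete.\<close>

lemma L2_ae_cong:
  assumes "sturm_liouville S" "f \<in> L2 S" "ae_eq S f g"
  shows "g \<in> L2 S"
proof -
  let ?M = "sl_measure S"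
  have AE: "AE x in lebesgue. indicator (sl_ivl S) x *\<^sub>R f x = indicator (sl_ivl S) x *\<^sub>R g x"
    using assms(3) unfolding ae_eq_def by eventually_elim (auto simp: indicator_def)
  have "(\<lambda>x. indicator (sl_ivl S) x *\<^sub>R f x) \<in> borel_measurable lebesgue"
    using assms(2) by (simp add: L2_def set_borel_measurable_def)
  from borel_measurable_AE[OF this AE] have g: "g \<in> borel_measurable ?M"
    by (simp add: measurable_sl_measure set_borel_measurable_def)
  have f: "f \<in> sq_integrable ?M" using assms by (simp add: L2_eq_sq_integrable)
  have "integrable ?M (\<lambda>x. (cmod (f x))\<^sup>2) \<longleftrightarrow> integrable ?M (\<lambda>x. (cmod (g x))\<^sup>2)"
    using assms f g
    by (intro integrable_cong_AE) (auto simp: ae_eq_iff_sl_measure elim: eventually_mono)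
  with f g show ?thesis
    by (simp add: L2_eq_sq_integrable assms(1) sq_integrable_def)
qed

lemma L2_inner_ae_cong:
  assumes S: "sturm_liouville S" and "f \<in> L2 S" "g \<in> L2 S" "ae_eq S f f'" "ae_eq S g g'"
  shows "L2_inner S f g = L2_inner S f' g'"
proof -
  have "f' \<in> L2 S" "g' \<in> L2 S" using L2_ae_cong[OF S] assms by blast+
  moreover have "inner_on (sl_measure S) f g = inner_on (sl_measure S) f' g'"
    unfolding inner_on_def
  proof (rule integral_cong_AE)
    show "AE x in sl_measure S. f x * cnj (g x) = f' x * cnj (g' x)"
      using assms(4,5) unfolding ae_eq_iff_sl_measure[OF S] by eventually_elim simp
  qed (use assms calculation in \<open>auto simp: L2_eq_sq_integrable sq_integrable_def\<close>)
  ultimately show ?thesis using assms by (simp add: L2_inner_eq_inner_on)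
qed


section \<open>Calculus of locally absolutely continuous classes\<close>

lemma abs_cont_on_add_mult:
  assumes f: "abs_cont_on c d f" and g: "abs_cont_on c d g"
  shows "abs_cont_on c d (\<lambda>x. f x + a * g x)"
  unfolding abs_cont_on_def
proof (intro allI impI)
  fix \<epsilon> :: real assume \<epsilon>: "\<epsilon> > 0"
  let ?b = "cmod a + 1"
  have b: "?b > 0" by (simp add: add_nonneg_pos)
  have "\<epsilon> / 2 > 0" using \<epsilon> by simp
  then obtain \<delta>1 where \<delta>1: "\<delta>1 > 0" "\<And>(N::nat) s t.
        (\<forall>i<N. c \<le> s i \<and> s i \<le> t i \<and> t i \<le> d) \<and>
        disjoint_family_on (\<lambda>i. {s i<..<t i}) {..<N} \<and>
        (\<Sum>i<N. t i - s i) < \<delta>1 \<Longrightarrow> (\<Sum>i<N. cmod (f (t i) - f (s i))) < \<epsilon> / 2"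
    using f unfolding abs_cont_on_def by blast
  have "\<epsilon> / (2 * ?b) > 0" using \<epsilon> b by simp
  then obtain \<delta>2 where \<delta>2: "\<delta>2 > 0" "\<And>(N::nat) s t.
        (\<forall>i<N. c \<le> s i \<and> s i \<le> t i \<and> t i \<le> d) \<and>
        disjoint_family_on (\<lambda>i. {s i<..<t i}) {..<N} \<and>
        (\<Sum>i<N. t i - s i) < \<delta>2 \<Longrightarrow> (\<Sum>i<N. cmod (g (t i) - g (s i))) < \<epsilon> / (2 * ?b)"
    using g unfolding abs_cont_on_def by blast
  show "\<exists>\<delta>>0. \<forall>(N::nat) s t.
        (\<forall>i<N. c \<le> s i \<and> s i \<le> t i \<and> t i \<le> d) \<and>
        disjoint_family_on (\<lambda>i. {s i<..<t i}) {..<N} \<and>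
        (\<Sum>i<N. t i - s i) < \<delta>
        \<longrightarrow> (\<Sum>i<N. cmod (f (t i) + a * g (t i) - (f (s i) + a * g (s i)))) < \<epsilon>"
  proof (intro exI[of _ "min \<delta>1 \<delta>2"] conjI allI impI)
    show "min \<delta>1 \<delta>2 > 0" using \<delta>1(1) \<delta>2(1) by simp
    fix N :: nat and s t :: "nat \<Rightarrow> real"
    assume H: "(\<forall>i<N. c \<le> s i \<and> s i \<le> t i \<and> t i \<le> d) \<and>
        disjoint_family_on (\<lambda>i. {s i<..<t i}) {..<N} \<and> (\<Sum>i<N. t i - s i) < min \<delta>1 \<delta>2"
    have 1: "(\<Sum>i<N. cmod (f (t i) - f (s i))) < \<epsilon> / 2"
      using H by (intro \<delta>1(2)) auto
    have "(\<Sum>i<N. cmod (g (t i) - g (s i))) < \<epsilon> / (2 * ?b)"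
      using H by (intro \<delta>2(2)) auto
    then have 2: "?b * (\<Sum>i<N. cmod (g (t i) - g (s i))) < \<epsilon> / 2"
      using b by (simp add: field_simps)
    have "cmod (f (t i) + a * g (t i) - (f (s i) + a * g (s i)))
        \<le> cmod (f (t i) - f (s i)) + ?b * cmod (g (t i) - g (s i))" for i
    proof -
      have "f (t i) + a * g (t i) - (f (s i) + a * g (s i)) = (f (t i) - f (s i)) + a * (g (t i) - g (s i))"
        by (simp add: algebra_simps)
      then have "cmod (f (t i) + a * g (t i) - (f (s i) + a * g (s i)))
          \<le> cmod (f (t i) - f (s i)) + cmod a * cmod (g (t i) - g (s i))"
        using norm_triangle_ineq by (metis norm_mult)
      also have "\<dots> \<le> cmod (f (t i) - f (s i)) + ?b * cmod (g (t i) - g (s i))"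
        by (intro add_left_mono mult_right_mono) auto
      finally show ?thesis .
    qed
    then have "(\<Sum>i<N. cmod (f (t i) + a * g (t i) - (f (s i) + a * g (s i))))
        \<le> (\<Sum>i<N. cmod (f (t i) - f (s i)) + ?b * cmod (g (t i) - g (s i)))"
      by (intro sum_mono)
    also have "\<dots> = (\<Sum>i<N. cmod (f (t i) - f (s i))) + ?b * (\<Sum>i<N. cmod (g (t i) - g (s i)))"
      by (simp add: sum.distrib sum_distrib_left)
    also have "\<dots> < \<epsilon>" using 1 2 by linarith
    finally show "(\<Sum>i<N. cmod (f (t i) + a * g (t i) - (f (s i) + a * g (s i)))) < \<epsilon>" .
  qed
qed

lemma abs_cont_on_cnj: "abs_cont_on c d f \<Longrightarrow> abs_cont_on c d (\<lambda>x. cnj (f x))"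
  unfolding abs_cont_on_def by (simp flip: complex_cnj_diff)

text \<open>Continuity is the case of families consisting of a single interval.\<close>

lemma abs_cont_on_imp_continuous_on:
  assumes "abs_cont_on c d f"
  shows "continuous_on {c..d} f"
  unfolding continuous_on_iff
proof (intro ballI allI impI)
  fix x and \<epsilon> :: real assume x: "x \<in> {c..d}" and "\<epsilon> > 0"
  then obtain \<delta> where \<delta>: "\<delta> > 0" "\<And>(N::nat) s t.
        (\<forall>i<N. c \<le> s i \<and> s i \<le> t i \<and> t i \<le> d) \<and>
        disjoint_family_on (\<lambda>i. {s i<..<t i}) {..<N} \<and>
        (\<Sum>i<N. t i - s i) < \<delta> \<Longrightarrow> (\<Sum>i<N. cmod (f (t i) - f (s i))) < \<epsilon>"
    using assms unfolding abs_cont_on_def by blast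
  show "\<exists>\<delta>>0. \<forall>y\<in>{c..d}. dist y x < \<delta> \<longrightarrow> dist (f y) (f x) < \<epsilon>"
  proof (intro exI[of _ \<delta>] conjI ballI impI \<delta>(1))
    fix y assume y: "y \<in> {c..d}" "dist y x < \<delta>"
    have "(\<Sum>i<(1::nat). cmod (f (max x y) - f (min x y))) < \<epsilon>"
      using x y by (intro \<delta>(2)) (auto simp: disjoint_family_on_def dist_real_def)
    then show "dist (f y) (f x) < \<epsilon>"
      by (auto simp: dist_norm max_def min_def norm_minus_commute split: if_splits)
  qed
qed

lemma AC_loc_add_mult: "AC_loc S f \<Longrightarrow> AC_loc S g \<Longrightarrow> AC_loc S (\<lambda>x. f x + a * g x)"
  by (simp add: AC_loc_def abs_cont_on_add_mult)

lemma AC_loc_cnj: "AC_loc S f \<Longrightarrow> AC_loc S (\<lambda>x. cnj (f x))"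
  by (simp add: AC_loc_def abs_cont_on_cnj)

lemma AC_loc_imp_continuous_on:
  assumes "AC_loc S f"
  shows "continuous_on (sl_ivl S) f"
  unfolding continuous_on_eq_continuous_at[OF open_sl_ivl]
proof
  fix x assume "x \<in> sl_ivl S"
  then obtain \<delta> where \<delta>: "\<delta> > 0" "{x - \<delta>..x + \<delta>} \<subseteq> sl_ivl S"
    by (rule sl_ivl_nbhd)
  have "continuous_on {x - \<delta>..x + \<delta>} f"
    using assms \<delta>(2) by (intro abs_cont_on_imp_continuous_on) (simp add: AC_loc_def)
  then show "isCont f x"
    using \<delta>(1) by (auto intro: continuous_on_interior)
qed

text \<open>If the two continuous functions differed at \<open>x\<close>, they would differ on an interval of positive
  length. This is what makes pointwise statements about the maximal domain, such as equality of sets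
  of functions, accessible to arguments in \<open>L\<^sup>2\<close>.\<close>

lemma AC_loc_ae_eq_imp_eq:
  assumes f: "AC_loc S f" and g: "AC_loc S g" and ae: "ae_eq S f g" and x: "x \<in> sl_ivl S"
  shows "f x = g x"
proof (rule ccontr)
  assume ne: "f x \<noteq> g x"
  have "isCont (\<lambda>y. f y - g y) x"
    using AC_loc_imp_continuous_on[OF f] AC_loc_imp_continuous_on[OF g] x
    by (intro isCont_diff) (simp_all add: continuous_on_eq_continuous_at[OF open_sl_ivl])
  then have "\<forall>\<^sub>F y in at x. f y - g y \<noteq> 0"
    using ne by (intro tendsto_imp_eventually_ne[of _ "f x - g x"]) (auto simp: isCont_def)
  then have "\<forall>\<^sub>F y in nhds x. f y \<noteq> g y"
    using ne by (auto simp: eventually_nhds_conv_at)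
  then obtain \<epsilon> where \<epsilon>: "\<epsilon> > 0" "\<And>y. dist y x < \<epsilon> \<Longrightarrow> f y \<noteq> g y"
    by (auto simp: eventually_nhds_metric)
  obtain \<delta> where \<delta>: "\<delta> > 0" "{x - \<delta>..x + \<delta>} \<subseteq> sl_ivl S"
    using x by (rule sl_ivl_nbhd)
  define \<eta> where "\<eta> = min \<epsilon> \<delta>"
  have \<eta>: "\<eta> > 0" using \<epsilon>(1) \<delta>(1) by (simp add: \<eta>_def)
  have "AE y in lebesgue. y \<notin> {x<..<x + \<eta>}"
    using ae unfolding ae_eq_def
  proof eventually_elim
    case (elim y)
    show ?case
    proof
      assume y: "y \<in> {x<..<x + \<eta>}"
      then have "dist y x < \<epsilon>" "y \<in> {x - \<delta>..x + \<delta>}"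
        using \<delta>(1) by (simp_all add: \<eta>_def dist_real_def min_def split: if_splits)
      then show False using \<epsilon>(2) \<delta>(2) elim by blast
    qed
  qed
  then have "{x<..<x + \<eta>} \<in> null_sets lebesgue"
    by (subst AE_iff_null_sets) auto
  then have "emeasure lborel {x<..<x + \<eta>} = 0"
    by (simp add: null_sets_def)
  then show False using \<eta> by simp
qed

text \<open>Two locally absolutely continuous representatives of \<open>f\<close> agree everywhere on the interval, so they
  have the same derivative wherever it exists.\<close>

lemma has_ac_deriv_unique:
  assumes "has_ac_deriv S f g" "has_ac_deriv S f h"
  shows "ae_eq S g h"
proof -
  obtain u where u: "AC_loc S u" "ae_eq S u f"
    "AE x\<in>sl_ivl S in lebesgue. (u has_vector_derivative g x) (at x)"
    using assms(1) by (auto simp: has_ac_deriv_def)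
  obtain v where v: "AC_loc S v" "ae_eq S v f"
    "AE x\<in>sl_ivl S in lebesgue. (v has_vector_derivative h x) (at x)"
    using assms(2) by (auto simp: has_ac_deriv_def)
  have uv: "u x = v x" if "x \<in> sl_ivl S" for x
    using AC_loc_ae_eq_imp_eq[OF u(1) v(1) _ that] u(2) v(2) ae_eq_sym ae_eq_trans by blast
  show ?thesis
    using u(3) v(3) unfolding ae_eq_def
  proof eventually_elim
    case (elim x)
    show ?case
    proof
      assume x: "x \<in> sl_ivl S"
      then have "(v has_vector_derivative g x) (at x)"
        using elim(1) by (intro has_vector_derivative_transform_within_open[of u _ _ _ v, OF _ open_sl_ivl x uv]) auto
      then show "g x = h x"
        using elim(2) x vector_derivative_unique_at by blast
    qed
  qed
qed

lemma has_ac_deriv_add_mult: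
  assumes "has_ac_deriv S f f'" "has_ac_deriv S g g'"
  shows "has_ac_deriv S (\<lambda>x. f x + a * g x) (\<lambda>x. f' x + a * g' x)"
proof -
  obtain u where u: "AC_loc S u" "ae_eq S u f"
    "AE x\<in>sl_ivl S in lebesgue. (u has_vector_derivative f' x) (at x)"
    using assms(1) by (auto simp: has_ac_deriv_def)
  obtain v where v: "AC_loc S v" "ae_eq S v g"
    "AE x\<in>sl_ivl S in lebesgue. (v has_vector_derivative g' x) (at x)"
    using assms(2) by (auto simp: has_ac_deriv_def)
  have "AE x\<in>sl_ivl S in lebesgue. ((\<lambda>x. u x + a * v x) has_vector_derivative f' x + a * g' x) (at x)"
    using u(3) v(3)
    by eventually_elim (auto intro!: has_vector_derivative_add has_vector_derivative_mult_right)
  then show ?thesis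
    using AC_loc_add_mult[OF u(1) v(1)] ae_eq_add_mult[OF u(2) v(2)]
    unfolding has_ac_deriv_def by blast
qed

lemma has_ac_deriv_cnj:
  assumes "has_ac_deriv S f f'"
  shows "has_ac_deriv S (\<lambda>x. cnj (f x)) (\<lambda>x. cnj (f' x))"
proof -
  obtain u where u: "AC_loc S u" "ae_eq S u f"
    "AE x\<in>sl_ivl S in lebesgue. (u has_vector_derivative f' x) (at x)"
    using assms by (auto simp: has_ac_deriv_def)
  have "AE x\<in>sl_ivl S in lebesgue. ((\<lambda>x. cnj (u x)) has_vector_derivative cnj (f' x)) (at x)"
    using u(3) by eventually_elim (auto intro!: has_vector_derivative_cnj)
  then show ?thesis
    using AC_loc_cnj[OF u(1)] ae_eq_cnj[OF u(2)] unfolding has_ac_deriv_def by blast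
qed

lemma has_ac_deriv_cong:
  assumes "ae_eq S f g"
  shows "has_ac_deriv S f = has_ac_deriv S g"
  using assms ae_eq_sym[OF assms] unfolding has_ac_deriv_def fun_eq_iff by (meson ae_eq_trans)

text \<open>The choice operator sees only the predicate, and this is the same for both functions; so the
  equality holds pointwise and not just almost everywhere.\<close>

lemma ac_deriv_cong: "ae_eq S f g \<Longrightarrow> ac_deriv S f = ac_deriv S g"
  by (simp add: ac_deriv_def has_ac_deriv_cong)

lemma AC_loc_class_cong: "ae_eq S f g \<Longrightarrow> AC_loc_class S f \<longleftrightarrow> AC_loc_class S g"
  by (simp add: AC_loc_class_def has_ac_deriv_cong)

lemma has_ac_deriv_ac_deriv: "AC_loc_class S f \<Longrightarrow> has_ac_deriv S f (ac_deriv S f)"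
  unfolding AC_loc_class_def ac_deriv_def by (rule someI_ex[of "has_ac_deriv S f"])

lemma AC_loc_class_add_mult:
  "AC_loc_class S f \<Longrightarrow> AC_loc_class S g \<Longrightarrow> AC_loc_class S (\<lambda>x. f x + a * g x)"
  unfolding AC_loc_class_def using has_ac_deriv_add_mult[of S f _ g _ a] by blast

lemma AC_loc_class_cnj: "AC_loc_class S f \<Longrightarrow> AC_loc_class S (\<lambda>x. cnj (f x))"
  unfolding AC_loc_class_def using has_ac_deriv_cnj[of S f] by blast

lemma ac_deriv_add_mult:
  assumes "AC_loc_class S f" "AC_loc_class S g"
  shows "ae_eq S (ac_deriv S (\<lambda>x. f x + a * g x)) (\<lambda>x. ac_deriv S f x + a * ac_deriv S g x)"
  by (rule has_ac_deriv_unique[OF has_ac_deriv_ac_deriv[OF AC_loc_class_add_mult[OF assms]]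
        has_ac_deriv_add_mult[OF assms[THEN has_ac_deriv_ac_deriv]]])

lemma ac_deriv_cnj:
  assumes "AC_loc_class S f"
  shows "ae_eq S (ac_deriv S (\<lambda>x. cnj (f x))) (\<lambda>x. cnj (ac_deriv S f x))"
  by (rule has_ac_deriv_unique[OF has_ac_deriv_ac_deriv[OF AC_loc_class_cnj[OF assms]]
        has_ac_deriv_cnj[OF assms[THEN has_ac_deriv_ac_deriv]]])


section \<open>Powers of the expression and the maximal domain\<close>

text \<open>This is the smoothness part of the maximal domain. It is singled out because it obeys a recursion that
  peels off the innermost application of the expression, which membership in the maximal domain does not:
  there square integrability is a condition on the function and its last power alone.\<close>

definition regular :: "sl_expr \<Rightarrow> nat \<Rightarrow> (real \<Rightarrow> complex) \<Rightarrow> bool" where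
  "regular S n f \<longleftrightarrow> (\<forall>k<2*n. AC_loc_class S (quasi_deriv S k f))"

abbreviation p_deriv :: "sl_expr \<Rightarrow> (real \<Rightarrow> complex) \<Rightarrow> real \<Rightarrow> complex" where
  "p_deriv S f \<equiv> \<lambda>x. of_real (coeff_p S x) * ac_deriv S f x"

lemma sl_pow_0 [simp]: "sl_pow S 0 f = f"
  by (simp add: sl_pow_def)

lemma sl_pow_Suc: "sl_pow S (Suc n) f = sl_pow S n (sl S f)"
  by (simp add: sl_pow_def funpow_swap1)

lemma regular_0 [simp]: "regular S 0 f"
  by (simp add: regular_def)

lemma regular_Suc:
  "regular S (Suc n) f \<longleftrightarrow>
     AC_loc_class S f \<and> AC_loc_class S (p_deriv S f) \<and> regular S n (sl S f)"
proof -
  have "quasi_deriv S (Suc (Suc k)) f = quasi_deriv S k (sl S f)" for k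
    by (simp add: quasi_deriv_def sl_pow_Suc)
  moreover have "quasi_deriv S 0 f = f" "quasi_deriv S (Suc 0) f = p_deriv S f"
    by (simp_all add: quasi_deriv_def)
  ultimately show ?thesis
    by (simp add: regular_def All_less_Suc2)
qed

lemma sl_cong: "ae_eq S f g \<Longrightarrow> ae_eq S (sl S f) (sl S g)"
  unfolding sl_def using ac_deriv_cong[of S f g]
  unfolding ae_eq_def by (auto elim: eventually_mono)

lemma sl_pow_cong: "ae_eq S f g \<Longrightarrow> ae_eq S (sl_pow S n f) (sl_pow S n g)"
  by (induction n arbitrary: f g) (auto simp: sl_pow_Suc sl_cong)

lemma regular_cong: "ae_eq S f g \<Longrightarrow> regular S n f \<Longrightarrow> regular S n g"
proof (induction n arbitrary: f g)
  case (Suc n)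
  have "regular S n (sl S g)"
    using Suc.IH[OF sl_cong[OF Suc.prems(1)]] Suc.prems(2) by (simp add: regular_Suc)
  then show ?case
    using Suc.prems by (simp add: regular_Suc ac_deriv_cong AC_loc_class_cong)
qed simp

lemma p_deriv_add_mult:
  assumes "AC_loc_class S f" "AC_loc_class S g"
  shows "ae_eq S (p_deriv S (\<lambda>x. f x + a * g x)) (\<lambda>x. p_deriv S f x + a * p_deriv S g x)"
  using ac_deriv_add_mult[OF assms, of a] unfolding ae_eq_def
  by eventually_elim (auto simp: algebra_simps)

lemma sl_add_mult:
  assumes "AC_loc_class S f" "AC_loc_class S g"
    and "AC_loc_class S (p_deriv S f)" "AC_loc_class S (p_deriv S g)"
  shows "ae_eq S (sl S (\<lambda>x. f x + a * g x)) (\<lambda>x. sl S f x + a * sl S g x)"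
proof -
  have "ac_deriv S (p_deriv S (\<lambda>x. f x + a * g x)) = ac_deriv S (\<lambda>x. p_deriv S f x + a * p_deriv S g x)"
    by (intro ac_deriv_cong p_deriv_add_mult assms)
  then show ?thesis
    using ac_deriv_add_mult[OF assms(3,4), of a] unfolding ae_eq_def sl_def
    by (simp add: algebra_simps) (auto elim!: eventually_mono simp: algebra_simps add_divide_distrib)
qed

lemma regular_add_mult:
  assumes "regular S n f" "regular S n g"
  shows "regular S n (\<lambda>x. f x + a * g x)"
    and "ae_eq S (sl_pow S n (\<lambda>x. f x + a * g x)) (\<lambda>x. sl_pow S n f x + a * sl_pow S n g x)"
  using assms
proof (induction n arbitrary: f g)
  case (Suc n)
  {
    case 1
    have "ae_eq S (\<lambda>x. sl S f x + a * sl S g x) (sl S (\<lambda>x. f x + a * g x))"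
      using 1 by (intro ae_eq_sym[OF sl_add_mult]) (auto simp: regular_Suc)
    then have "regular S n (sl S (\<lambda>x. f x + a * g x))"
      by (rule regular_cong) (use 1 Suc.IH in \<open>auto simp: regular_Suc\<close>)
    moreover have "AC_loc_class S (p_deriv S (\<lambda>x. f x + a * g x))"
      using 1 by (subst AC_loc_class_cong[OF p_deriv_add_mult])
        (auto simp: regular_Suc intro: AC_loc_class_add_mult)
    ultimately show ?case
      using 1 by (auto simp: regular_Suc intro: AC_loc_class_add_mult)
  next
    case 2
    have "ae_eq S (sl S (\<lambda>x. f x + a * g x)) (\<lambda>x. sl S f x + a * sl S g x)"
      using 2 by (intro sl_add_mult) (auto simp: regular_Suc)
    then have "ae_eq S (sl_pow S n (sl S (\<lambda>x. f x + a * g x))) (sl_pow S n (\<lambda>x. sl S f x + a * sl S g x))"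
      by (rule sl_pow_cong)
    also have "ae_eq S \<dots> (\<lambda>x. sl_pow S n (sl S f) x + a * sl_pow S n (sl S g) x)"
      using 2 Suc.IH(2) by (auto simp: regular_Suc)
    finally show ?case by (simp add: sl_pow_Suc)
  }
qed auto

lemma p_deriv_cnj:
  assumes "AC_loc_class S f"
  shows "ae_eq S (p_deriv S (\<lambda>x. cnj (f x))) (\<lambda>x. cnj (p_deriv S f x))"
  using ac_deriv_cnj[OF assms] unfolding ae_eq_def
  by eventually_elim auto

lemma sl_cnj:
  assumes "AC_loc_class S f" "AC_loc_class S (p_deriv S f)"
  shows "ae_eq S (sl S (\<lambda>x. cnj (f x))) (\<lambda>x. cnj (sl S f x))"
proof -
  have "ac_deriv S (p_deriv S (\<lambda>x. cnj (f x))) = ac_deriv S (\<lambda>x. cnj (p_deriv S f x))"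
    by (intro ac_deriv_cong p_deriv_cnj assms)
  then show ?thesis
    using ac_deriv_cnj[OF assms(2)] unfolding ae_eq_def sl_def
    by (auto elim!: eventually_mono)
qed

lemma regular_cnj:
  assumes "regular S n f"
  shows "regular S n (\<lambda>x. cnj (f x))"
    and "ae_eq S (sl_pow S n (\<lambda>x. cnj (f x))) (\<lambda>x. cnj (sl_pow S n f x))"
  using assms
proof (induction n arbitrary: f)
  case (Suc n)
  {
    case 1
    have "ae_eq S (\<lambda>x. cnj (sl S f x)) (sl S (\<lambda>x. cnj (f x)))"
      using 1 by (intro ae_eq_sym[OF sl_cnj]) (auto simp: regular_Suc)
    then have "regular S n (sl S (\<lambda>x. cnj (f x)))"
      by (rule regular_cong) (use 1 Suc.IH in \<open>auto simp: regular_Suc\<close>)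
    moreover have "AC_loc_class S (p_deriv S (\<lambda>x. cnj (f x)))"
      using 1 by (subst AC_loc_class_cong[OF p_deriv_cnj])
        (auto simp only: regular_Suc intro!: AC_loc_class_cnj)
    ultimately show ?case
      using 1 by (auto simp: regular_Suc intro: AC_loc_class_cnj)
  next
    case 2
    have "ae_eq S (sl S (\<lambda>x. cnj (f x))) (\<lambda>x. cnj (sl S f x))"
      using 2 by (intro sl_cnj) (auto simp: regular_Suc)
    then have "ae_eq S (sl_pow S n (sl S (\<lambda>x. cnj (f x)))) (sl_pow S n (\<lambda>x. cnj (sl S f x)))"
      by (rule sl_pow_cong)
    also have "ae_eq S \<dots> (\<lambda>x. cnj (sl_pow S n (sl S f) x))"
      using 2 Suc.IH(2) by (auto simp: regular_Suc)
    finally show ?case by (simp add: sl_pow_Suc)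
  }
qed auto

lemma sl_max_iff:
  "f \<in> sl_max S n \<longleftrightarrow> (\<forall>x. x \<notin> sl_ivl S \<longrightarrow> f x = 0) \<and> AC_loc S f \<and> regular S n f \<and>
     f \<in> L2 S \<and> sl_pow S n f \<in> L2 S"
  by (simp add: sl_max_def regular_def)

text \<open>Functions in a maximal domain are continuous on the interval and vanish outside it, so that an
  almost-everywhere class contains at most one of them.\<close>

lemma sl_max_ae_eq_imp_eq:
  assumes "f \<in> sl_max S n" "g \<in> sl_max S k" "ae_eq S f g"
  shows "f = g"
proof
  fix x show "f x = g x"
    using assms AC_loc_ae_eq_imp_eq[of S f g x] by (cases "x \<in> sl_ivl S") (auto simp: sl_max_iff)
qed

lemma L2_add_mult:
  assumes "sturm_liouville S" "f \<in> L2 S" "g \<in> L2 S"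
  shows "(\<lambda>x. f x + a * g x) \<in> L2 S"
  using assms by (simp add: L2_eq_sq_integrable sq_integrable_add_mult)

lemma L2_cnj: "f \<in> L2 S \<Longrightarrow> (\<lambda>x. cnj (f x)) \<in> L2 S"
proof -
  have "indicator (sl_ivl S) x *\<^sub>R cnj (f x) = cnj (indicator (sl_ivl S) x *\<^sub>R f x)" for x
    by simp
  then show "f \<in> L2 S \<Longrightarrow> (\<lambda>x. cnj (f x)) \<in> L2 S"
    by (simp only: L2_def set_borel_measurable_def complex_mod_cnj mem_Collect_eq borel_measurable_cnj)
qed

lemma sl_max_add_mult:
  assumes S: "sturm_liouville S" and f: "f \<in> sl_max S n" and g: "g \<in> sl_max S n"
  shows "(\<lambda>x. f x + a * g x) \<in> sl_max S n"
proof -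
  have "sl_pow S n (\<lambda>x. f x + a * g x) \<in> L2 S"
    by (rule L2_ae_cong[OF S L2_add_mult[OF S] ae_eq_sym[OF regular_add_mult(2)]])
       (use f g in \<open>auto simp: sl_max_iff\<close>)
  then show ?thesis
    using f g by (auto simp: sl_max_iff intro: AC_loc_add_mult regular_add_mult L2_add_mult[OF S])
qed

text \<open>The coefficients are real, so the powers commute with conjugation; all four functions are square
  integrable, so the integral of the difference may be split.\<close>

lemma sl_bracket_eq:
  assumes S: "sturm_liouville S" and f: "f \<in> sl_max S n" and g: "g \<in> sl_max S n"
  shows "sl_bracket S n f g = L2_inner S (sl_pow S n f) g - L2_inner S f (sl_pow S n g)"
proof -
  let ?M = "sl_measure S" and ?A = "sl_pow S n"
  have cnj: "ae_eq S (?A (\<lambda>y. cnj (g y))) (\<lambda>x. cnj (?A g x))"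
    using g by (intro regular_cnj) (simp add: sl_max_iff)
  have L2: "?A f \<in> L2 S" "?A g \<in> L2 S" "f \<in> L2 S" "g \<in> L2 S"
    using f g by (auto simp: sl_max_iff)
  have L2': "?A (\<lambda>y. cnj (g y)) \<in> L2 S"
    using L2_ae_cong[OF S L2_cnj[OF L2(2)] ae_eq_sym[OF cnj]] .
  have meas [measurable]: "?A f \<in> borel_measurable ?M" "f \<in> borel_measurable ?M"
    "?A g \<in> borel_measurable ?M" "g \<in> borel_measurable ?M" "?A (\<lambda>y. cnj (g y)) \<in> borel_measurable ?M"
    using L2 L2' by (auto simp: L2_eq_sq_integrable S sq_integrable_def)
  have "sl_bracket S n f g = (LINT x|?M. ?A f x * cnj (g x) - ?A (\<lambda>y. cnj (g y)) x * f x)"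
    unfolding sl_bracket_def by (rule integral_sl_measure[OF S, symmetric]) measurable
  also have "\<dots> = (LINT x|?M. ?A f x * cnj (g x) - f x * cnj (?A g x))"
  proof (rule integral_cong_AE)
    show "AE x in ?M. ?A f x * cnj (g x) - ?A (\<lambda>y. cnj (g y)) x * f x = ?A f x * cnj (g x) - f x * cnj (?A g x)"
      using cnj unfolding ae_eq_iff_sl_measure[OF S] by eventually_elim simp
  qed measurable
  also have "\<dots> = inner_on ?M (?A f) g - inner_on ?M f (?A g)"
    unfolding inner_on_def using L2
    by (intro Bochner_Integration.integral_diff integrable_mult_cnj) (simp_all add: L2_eq_sq_integrable S)
  finally show ?thesis using L2 by (simp add: L2_inner_eq_inner_on S)
qed

lemma sl_bracket_add_mult:
  assumes S: "sturm_liouville S" and f: "f \<in> sl_max S n" and g: "g \<in> sl_max S n" and h: "h \<in> sl_max S n"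
  shows "sl_bracket S n (\<lambda>x. f x + a * g x) h = sl_bracket S n f h + a * sl_bracket S n g h"
proof -
  let ?fg = "\<lambda>x. f x + a * g x" and ?A = "sl_pow S n"
  note max = f g h sl_max_add_mult[OF S f g, of a]
  have L2: "f \<in> L2 S" "g \<in> L2 S" "h \<in> L2 S" "?A f \<in> L2 S" "?A g \<in> L2 S" "?A h \<in> L2 S" "?A ?fg \<in> L2 S"
    using max by (auto simp: sl_max_iff)
  have "L2_inner S (?A ?fg) h = L2_inner S (\<lambda>x. ?A f x + a * ?A g x) h"
    using L2 f g by (intro L2_inner_ae_cong[OF S] regular_add_mult) (auto simp: sl_max_iff)
  then show ?thesis
    using L2 L2_add_mult[OF S]
    by (simp add: sl_bracket_eq[OF S] max L2_inner_eq_inner_on[OF S] L2_eq_sq_integrable[OF S]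
        inner_on_add_mult_left algebra_simps)
qed

lemma sl_bracket_commute:
  assumes S: "sturm_liouville S" and f: "f \<in> sl_max S n" and g: "g \<in> sl_max S n"
  shows "sl_bracket S n g f = - cnj (sl_bracket S n f g)"
proof -
  have "f \<in> L2 S" "g \<in> L2 S" "sl_pow S n f \<in> L2 S" "sl_pow S n g \<in> L2 S"
    using f g by (auto simp: sl_max_iff)
  then show ?thesis
    by (simp add: sl_bracket_eq[OF S] f g L2_inner_eq_inner_on[OF S] flip: inner_on_commute)
qed

section \<open>Choosing a nonsingular square submatrix\<close>

text \<open>If the rows of an infinite matrix with \<open>N\<close> columns have no common nontrivial kernel vector, then \<open>N\<close>
  of its rows form a nonsingular square matrix; the two conclusions say that this matrix has trivial
  kernel on either side. The induction is one step of Gaussian elimination: some row \<open>k0\<close> has a nonzero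
  entry in the last column, and \<open>b\<close> is the matrix after clearing that column with row \<open>k0\<close>.\<close>

lemma nonsingular_square_rows:
  fixes a :: "'k \<Rightarrow> nat \<Rightarrow> 'a :: field"
  assumes "\<And>c. (\<And>k. (\<Sum>j<N. c j * a k j) = 0) \<Longrightarrow> \<forall>j<N. c j = 0"
  shows "\<exists>\<kappa>. (\<forall>c. (\<forall>i<N. (\<Sum>j<N. c j * a (\<kappa> i) j) = 0) \<longrightarrow> (\<forall>j<N. c j = 0)) \<and>
             (\<forall>\<alpha>. (\<forall>j<N. (\<Sum>i<N. \<alpha> i * a (\<kappa> i) j) = 0) \<longrightarrow> (\<forall>i<N. \<alpha> i = 0))"
  using assms
proof (induction N arbitrary: a)
  case (Suc N)
  obtain k0 where k0: "a k0 N \<noteq> 0"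
  proof (rule ccontr)
    assume "\<not> thesis"
    then have "a k N = 0" for k using that by blast
    then have "\<forall>j<Suc N. (if j = N then 1 else 0 :: 'a) = 0"
      by (intro Suc.prems) (simp add: sum.neutral)
    then show False by auto
  qed
  define b where "b k j = a k j - a k N * a k0 j / a k0 N" for k j
  \<comment> \<open>the last coordinate of the kernel vector of row \<open>k0\<close> that starts with \<open>c\<close>\<close>
  define e where "e c = - (\<Sum>j<N. c j * a k0 j) / a k0 N" for c
  have elim: "(\<Sum>j<N. c j * a k j) + e c * a k N = (\<Sum>j<N. c j * b k j)" for c k
    by (simp add: b_def e_def right_diff_distrib sum_subtractf sum_distrib_left sum_divide_distrib mult_ac)
  have kernel: "\<forall>j<N. c j = 0" if c: "\<And>k. (\<Sum>j<N. c j * b k j) = 0" for c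
  proof -
    have ext: "\<forall>j<Suc N. (c(N := e c)) j = 0"
      using c elim by (intro Suc.prems) simp
    show ?thesis
    proof (intro allI impI)
      fix j assume "j < N"
      then show "c j = 0" using ext[rule_format, of j] by simp
    qed
  qed
  have "\<exists>\<kappa>. (\<forall>c. (\<forall>i<N. (\<Sum>j<N. c j * b (\<kappa> i) j) = 0) \<longrightarrow> (\<forall>j<N. c j = 0)) \<and>
      (\<forall>\<alpha>. (\<forall>j<N. (\<Sum>i<N. \<alpha> i * b (\<kappa> i) j) = 0) \<longrightarrow> (\<forall>i<N. \<alpha> i = 0))"
    by (rule Suc.IH) (rule kernel)
  then obtain \<kappa> where
    "\<forall>c. (\<forall>i<N. (\<Sum>j<N. c j * b (\<kappa> i) j) = 0) \<longrightarrow> (\<forall>j<N. c j = 0)"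
    "\<forall>\<alpha>. (\<forall>j<N. (\<Sum>i<N. \<alpha> i * b (\<kappa> i) j) = 0) \<longrightarrow> (\<forall>i<N. \<alpha> i = 0)"
    by (elim exE conjE)
  note \<kappa>1 = this(1)[THEN spec, THEN mp] and \<kappa>2 = this(2)[THEN spec, THEN mp]
  show ?case
  proof (intro exI[of _ "\<kappa>(N := k0)"] conjI allI impI)
    fix c j assume c: "\<forall>i<Suc N. (\<Sum>j<Suc N. c j * a ((\<kappa>(N := k0)) i) j) = 0" and j: "j < Suc N"
    have "(\<Sum>j<N. c j * a k0 j) + c N * a k0 N = 0"
      using c[rule_format, of N] by simp
    then have cN: "c N = e c"
      using k0 by (simp add: e_def field_simps eq_neg_iff_add_eq_0 add.commute)
    have "(\<Sum>j<N. c j * b (\<kappa> i) j) = 0" if "i < N" for i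
      using c[rule_format, of i] that cN by (simp add: elim[symmetric])
    then have "\<forall>j<N. c j = 0" by (rule \<kappa>1[OF allI[OF impI]])
    then show "c j = 0" using j cN by (cases "j = N") (auto simp: e_def)
  next
    fix \<alpha> i assume \<alpha>: "\<forall>j<Suc N. (\<Sum>i<Suc N. \<alpha> i * a ((\<kappa>(N := k0)) i) j) = 0" and i: "i < Suc N"
    have \<alpha>': "(\<Sum>i<N. \<alpha> i * a (\<kappa> i) j) = - \<alpha> N * a k0 j" if "j < Suc N" for j
      using \<alpha>[rule_format, OF that] by (simp add: eq_neg_iff_add_eq_0)
    have "(\<Sum>i<N. \<alpha> i * b (\<kappa> i) j) = 0" if "j < N" for j
    proof -
      have "(\<Sum>i<N. \<alpha> i * b (\<kappa> i) j)
          = (\<Sum>i<N. \<alpha> i * a (\<kappa> i) j) - (\<Sum>i<N. \<alpha> i * a (\<kappa> i) N) * (a k0 j / a k0 N)"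
        by (simp add: b_def right_diff_distrib sum_subtractf sum_distrib_left sum_divide_distrib mult_ac)
      then show ?thesis using \<alpha>'[of j] \<alpha>'[of N] that k0 by simp
    qed
    then have "\<forall>i<N. \<alpha> i = 0" by (rule \<kappa>2[OF allI[OF impI]])
    moreover from this have "\<alpha> N = 0" using \<alpha>'[of N] k0 by simp
    ultimately show "\<alpha> i = 0" using i by (cases "i = N") auto
  qed
qed simp

lemma sum_fun_apply: "(\<Sum>i\<in>I. f i) x = (\<Sum>i\<in>I. f i x)"
  by (induction I rule: infinite_finite_induct) auto

section \<open>Domains of powers\<close>

lemma op_pow_dom_antimono:
  assumes "D \<subseteq> L2 S"
  shows "op_pow_dom S A D (Suc n) \<subseteq> op_pow_dom S A D n"
proof (induction n)
  case 0
  show ?case using assms by auto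
next
  case (Suc n)
  then show ?case by fastforce
qed

lemma op_pow_dom_add_mult:
  assumes S: "sturm_liouville S"
    and lin: "\<And>f g a. f \<in> D \<Longrightarrow> g \<in> D \<Longrightarrow> (\<lambda>x. f x + a * g x) \<in> D \<and>
      ae_eq S (A (\<lambda>x. f x + a * g x)) (\<lambda>x. A f x + a * A g x)"
    and "f \<in> op_pow_dom S A D n" "g \<in> op_pow_dom S A D n"
  shows "(\<lambda>x. f x + a * g x) \<in> op_pow_dom S A D n"
  using assms(3,4)
proof (induction n arbitrary: f g)
  case 0
  then show ?case by (simp add: L2_add_mult S)
next
  case (Suc n)
  obtain f' g' where f': "f' \<in> op_pow_dom S A D n" "ae_eq S (A f) f'"
    and g': "g' \<in> op_pow_dom S A D n" "ae_eq S (A g) g'"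
    using Suc.prems by auto
  have "ae_eq S (A (\<lambda>x. f x + a * g x)) (\<lambda>x. f' x + a * g' x)"
    using lin[of f g a] Suc.prems ae_eq_add_mult[OF f'(2) g'(2)] ae_eq_trans by fastforce
  then show ?case using Suc.IH[OF f'(1) g'(1)] lin[of f g a] Suc.prems by auto
qed

text \<open>Since \<open>A f + c f = g\<close> exchanges with \<open>A f = g - c f\<close>, it suffices that \<open>f\<close> belongs to the previous
  domain together with \<open>g\<close>, which holds because the domains are decreasing subspaces.\<close>

lemma op_pow_dom_shift:
  assumes S: "sturm_liouville S" and D: "D \<subseteq> L2 S"
    and lin: "\<And>f g a. f \<in> D \<Longrightarrow> g \<in> D \<Longrightarrow> (\<lambda>x. f x + a * g x) \<in> D \<and>
      ae_eq S (A (\<lambda>x. f x + a * g x)) (\<lambda>x. A f x + a * A g x)"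
  shows "op_pow_dom S (op_shift A c) D n = op_pow_dom S A D n"
proof (induction n)
  case (Suc n)
  show ?case
  proof (intro equalityI subsetI)
    fix f assume f: "f \<in> op_pow_dom S (op_shift A c) D (Suc n)"
    then obtain g where g: "g \<in> op_pow_dom S A D n" "ae_eq S (op_shift A c f) g"
      using Suc.IH by auto
    have "f \<in> op_pow_dom S A D n"
      using f op_pow_dom_antimono[OF D, of "op_shift A c" n] Suc.IH by blast
    with g(1) have "(\<lambda>x. g x + (- of_real c) * f x) \<in> op_pow_dom S A D n"
      by (intro op_pow_dom_add_mult[OF S lin])
    moreover have "ae_eq S (A f) (\<lambda>x. g x + (- of_real c) * f x)"
      using g(2) unfolding ae_eq_def op_shift_def by eventually_elim (auto simp: algebra_simps)
    ultimately show "f \<in> op_pow_dom S A D (Suc n)" using f by auto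
  next
    fix f assume f: "f \<in> op_pow_dom S A D (Suc n)"
    then obtain g where g: "g \<in> op_pow_dom S A D n" "ae_eq S (A f) g" by auto
    have "f \<in> op_pow_dom S A D n" using f op_pow_dom_antimono[OF D] by blast
    with g(1) have "(\<lambda>x. g x + of_real c * f x) \<in> op_pow_dom S A D n"
      by (intro op_pow_dom_add_mult[OF S lin])
    moreover have "ae_eq S (op_shift A c f) (\<lambda>x. g x + of_real c * f x)"
      using g(2) unfolding ae_eq_def op_shift_def by eventually_elim (auto simp: algebra_simps)
    ultimately show "f \<in> op_pow_dom S (op_shift A c) D (Suc n)" using f Suc.IH by auto
  qed
qed simp

section \<open>Eigenfunction expansion of the powers\<close>

locale sl_eigenbasis =
  fixes S :: sl_expr and D :: "(real \<Rightarrow> complex) set" and P :: "nat \<Rightarrow> real \<Rightarrow> complex"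
  assumes SL: "sturm_liouville S"
    and D_max: "D \<subseteq> sl_max S 1"
    and self_adj: "self_adjoint S (sl S) D"
    and eigen: "\<And>k. eigenfunction S (sl S) D (P k)"
    and complete_system: "complete_orthogonal_system S P"
begin

abbreviation "M \<equiv> sl_measure S"

lemma L2_iff: "f \<in> L2 S \<longleftrightarrow> f \<in> sq_integrable M"
  by (simp add: L2_eq_sq_integrable SL)

lemma inner_eq: "f \<in> L2 S \<Longrightarrow> g \<in> L2 S \<Longrightarrow> L2_inner S f g = inner_on M f g"
  by (rule L2_inner_eq_inner_on[OF SL])

lemma D_L2: "f \<in> D \<Longrightarrow> f \<in> L2 S" and sl_D_L2: "f \<in> D \<Longrightarrow> sl S f \<in> L2 S"
  using D_max by (auto simp: sl_max_iff sl_pow_Suc)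

lemma P_D: "P k \<in> D"
  using eigen by (simp add: eigenfunction_def)

lemma P_L2: "P k \<in> L2 S"
  by (rule D_L2[OF P_D])

lemma sl_symmetric: "f \<in> D \<Longrightarrow> g \<in> D \<Longrightarrow> L2_inner S (sl S f) g = L2_inner S f (sl S g)"
  using self_adj ae_eq_refl unfolding self_adjoint_def adjoint_graph_def by blast

lemma sl_adjoint:
  assumes "f \<in> L2 S" "h \<in> L2 S" "\<And>g. g \<in> D \<Longrightarrow> L2_inner S (sl S g) f = L2_inner S g h"
  shows "\<exists>g\<in>D. ae_eq S f g \<and> ae_eq S h (sl S g)"
  using self_adj assms unfolding self_adjoint_def adjoint_graph_def by blast

lemma sl_lin:
  assumes "f \<in> D" "g \<in> D"
  shows "(\<lambda>x. f x + a * g x) \<in> D \<and> ae_eq S (sl S (\<lambda>x. f x + a * g x)) (\<lambda>x. sl S f x + a * sl S g x)"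
proof
  have "cfun.subspace D" using self_adj by (simp add: self_adjoint_def)
  then have "f + (\<lambda>x. a * g x) \<in> D"
    using assms by (intro cfun.subspace_add cfun.subspace_scale)
  then show "(\<lambda>x. f x + a * g x) \<in> D" by (simp add: plus_fun_def)
  have "regular S 1 f" "regular S 1 g" using assms D_max by (auto simp: sl_max_iff)
  then show "ae_eq S (sl S (\<lambda>x. f x + a * g x)) (\<lambda>x. sl S f x + a * sl S g x)"
    by (intro sl_add_mult) (auto simp: regular_Suc)
qed

lemma P_norm_pos: "sq_norm_on M (P k) > 0"
proof -
  have "sq_norm_on M (P k) \<noteq> 0"
    using eigen[of k] P_L2[of k]
    by (simp add: eigenfunction_def ae_eq_iff_sl_measure SL L2_iff sq_norm_on_eq_0_iff)
  then show ?thesis using sq_norm_on_nonneg[of M "P k"] by linarith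
qed

definition unit_eigf :: "nat \<Rightarrow> real \<Rightarrow> complex" where
  "unit_eigf k = (\<lambda>x. (1 / of_real (sqrt (sq_norm_on M (P k)))) * P k x)"

lemma inner_unit_eigf_right:
  "inner_on M f (unit_eigf k) = inner_on M f (P k) / of_real (sqrt (sq_norm_on M (P k)))"
  unfolding unit_eigf_def by (subst (1 2) inner_on_commute) (simp only: inner_on_scale_left, simp)

sublocale orthonormal_basis_on M unit_eigf
proof
  show sq: "unit_eigf k \<in> sq_integrable M" for k
    using P_L2 unfolding unit_eigf_def L2_iff by (rule sq_integrable_scale)
  show "inner_on M (unit_eigf j) (unit_eigf k) = (if j = k then 1 else 0)" for j k
  proof -
    let ?n = "\<lambda>k. complex_of_real (sqrt (sq_norm_on M (P k)))"
    have "inner_on M (unit_eigf j) (unit_eigf k) = inner_on M (P j) (P k) / (?n j * ?n k)"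
      unfolding inner_unit_eigf_right unfolding unit_eigf_def inner_on_scale_left by simp
    also have "\<dots> = (if j = k then 1 else 0)"
    proof (cases "j = k")
      case True
      have "?n k * ?n k = of_real (sq_norm_on M (P k))"
        using sq_norm_on_nonneg[of M "P k"] by (simp flip: of_real_mult)
      then show ?thesis using True P_norm_pos[of k] by (simp add: inner_on_self)
    next
      case False
      then have "inner_on M (P j) (P k) = 0"
        using complete_system P_L2 by (simp add: complete_orthogonal_system_def flip: inner_eq)
      then show ?thesis using False by simp
    qed
    finally show ?thesis .
  qed
  show "AE x in M. f x = 0" if "f \<in> sq_integrable M" "\<And>k. inner_on M f (unit_eigf k) = 0" for f
  proof -
    have "L2_inner S f (P k) = 0" for k
      using that(2)[of k] that(1) P_norm_pos[of k] P_L2 by (simp add: inner_unit_eigf_right inner_eq L2_iff)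
    then have "ae_eq S f (\<lambda>x. 0)"
      using complete_system that(1) by (simp add: complete_orthogonal_system_def L2_iff)
    then show ?thesis by (simp add: ae_eq_iff_sl_measure SL)
  qed
qed

lemma unit_eigf_L2: "unit_eigf k \<in> L2 S"
  by (simp add: L2_iff e_sq)

lemma coeff_cong: "f \<in> L2 S \<Longrightarrow> ae_eq S f g \<Longrightarrow> coeff f k = coeff g k"
  using L2_inner_ae_cong[OF SL _ unit_eigf_L2 _ ae_eq_refl] L2_ae_cong[OF SL]
  by (metis inner_eq unit_eigf_L2)

lemma ae_eq_if_coeff_eq:
  "f \<in> L2 S \<Longrightarrow> g \<in> L2 S \<Longrightarrow> (\<And>k. coeff f k = coeff g k) \<Longrightarrow> ae_eq S f g"
  by (simp add: ae_eq_iff_sl_measure SL L2_iff coeff_eq_imp_AE_eq)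

lemma parseval_L2:
  "f \<in> L2 S \<Longrightarrow> g \<in> L2 S \<Longrightarrow> (\<lambda>k. coeff f k * cnj (coeff g k)) sums L2_inner S f g"
  using parseval[of f g] by (simp add: inner_eq flip: L2_iff)

lemma riesz_fischer_L2:
  "summable (\<lambda>k. (cmod (c k))\<^sup>2) \<Longrightarrow> \<exists>g\<in>L2 S. \<forall>k. coeff g k = c k"
  using riesz_fischer[of c] by (auto simp: L2_iff)

lemma coeff_P: "j \<noteq> k \<Longrightarrow> coeff (P k) j = 0"
  using complete_system P_L2 by (simp add: inner_unit_eigf_right complete_orthogonal_system_def flip: inner_eq)

text \<open>Eigenvalues of a symmetric operator are real.\<close>

lemma ex_eigenvalue: "\<exists>r::real. ae_eq S (sl S (P k)) (\<lambda>x. of_real r * P k x)"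
proof -
  obtain z where z: "ae_eq S (sl S (P k)) (\<lambda>x. z * P k x)"
    using eigen by (auto simp: eigenfunction_def)
  have zP: "(\<lambda>x. z * P k x) \<in> L2 S"
    by (rule L2_ae_cong[OF SL sl_D_L2[OF P_D] z])
  have "L2_inner S (sl S (P k)) (P k) = z * inner_on M (P k) (P k)"
    using L2_inner_ae_cong[OF SL sl_D_L2[OF P_D] P_L2 z ae_eq_refl]
    by (simp add: inner_eq zP P_L2 inner_on_scale_left)
  moreover have "L2_inner S (P k) (sl S (P k)) = cnj z * inner_on M (P k) (P k)"
    using L2_inner_ae_cong[OF SL P_L2 sl_D_L2[OF P_D] ae_eq_refl z]
    by (simp add: inner_eq zP P_L2) (subst inner_on_commute, simp add: inner_on_scale_left inner_on_self)
  ultimately have "z = cnj z"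
    using sl_symmetric[OF P_D P_D] P_norm_pos[of k] by (simp add: inner_on_self)
  then have "z = of_real (Re z)"
    by (metis Reals_cnj_iff complex_is_Real_iff of_real_Re)
  then show ?thesis using z by metis
qed

definition eigval :: "nat \<Rightarrow> real" where
  "eigval k = (SOME r. ae_eq S (sl S (P k)) (\<lambda>x. of_real r * P k x))"

lemma sl_P: "ae_eq S (sl S (P k)) (\<lambda>x. of_real (eigval k) * P k x)"
  unfolding eigval_def using ex_eigenvalue by (rule someI_ex)

lemma coeff_sl:
  assumes "f \<in> D"
  shows "coeff (sl S f) k = of_real (eigval k) * coeff f k"
proof -
  have P': "(\<lambda>x. of_real (eigval k) * P k x) \<in> L2 S"
    by (rule L2_ae_cong[OF SL sl_D_L2[OF P_D] sl_P])
  have "inner_on M (sl S f) (P k) = L2_inner S f (sl S (P k))"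
    using sl_symmetric[OF assms P_D] by (simp add: inner_eq sl_D_L2 assms P_L2)
  also have "\<dots> = inner_on M f (\<lambda>x. of_real (eigval k) * P k x)"
    using L2_inner_ae_cong[OF SL D_L2[OF assms] sl_D_L2[OF P_D] ae_eq_refl sl_P]
    by (simp add: inner_eq D_L2 assms P')
  also have "\<dots> = of_real (eigval k) * inner_on M f (P k)"
    by (subst (1 2) inner_on_commute) (simp add: inner_on_scale_left)
  finally show ?thesis by (simp add: inner_unit_eigf_right)
qed

abbreviation "pow_dom \<equiv> op_pow_dom S (sl S) D"

text \<open>The \<open>n\<close>th power contains every pair \<open>(f, h)\<close> that it should contain according to the eigenfunction
  coefficients. Since \<open>\<lambda>\<^sup>2 \<le> 1 + \<lambda>\<^bsup>2(n+1)\<^esup>\<close>, the products \<open>\<lambda>\<^sub>k * coeff f k\<close> are square summable and hence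
  are the coefficients of some \<open>g\<close>, even though nothing is known yet about the function \<open>sl S f\<close>.
  Parseval's identity shows that the adjoint maps \<open>f\<close> to \<open>g\<close>; self-adjointness puts \<open>f\<close> into the
  domain, and the induction continues with \<open>g\<close> and \<open>h\<close>.\<close>

lemma ex_pow_dom_if_coeff:
  assumes "f \<in> L2 S" "h \<in> L2 S" "\<And>k. coeff h k = of_real (eigval k)^n * coeff f k"
  shows "\<exists>g\<in>pow_dom n. ae_eq S f g \<and> ae_eq S h (sl_pow S n g)"
  using assms
proof (induction n arbitrary: f)
  case 0
  then have "ae_eq S h f" by (intro ae_eq_if_coeff_eq) auto
  with 0 show ?case by (auto intro!: bexI[of _ f])
next
  case (Suc n)
  have "summable (\<lambda>k. (cmod (coeff f k))\<^sup>2 + (cmod (coeff h k))\<^sup>2)"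
    using Suc.prems by (intro summable_add bessel) (auto simp: L2_iff)
  then have "summable (\<lambda>k. (cmod (of_real (eigval k) * coeff f k))\<^sup>2)"
  proof (rule summable_comparison_test')
    fix k :: nat
    let ?r = "(eigval k)\<^sup>2"
    have "?r \<le> 1 + ?r ^ Suc n"
    proof (cases "?r \<le> 1")
      case False
      then show ?thesis using self_le_power[of ?r "Suc n"] by simp
    qed (auto intro: add_increasing2)
    then have "?r * (cmod (coeff f k))\<^sup>2 \<le> (1 + ?r ^ Suc n) * (cmod (coeff f k))\<^sup>2"
      by (intro mult_right_mono) auto
    also have "\<dots> = (cmod (coeff f k))\<^sup>2 + (cmod (coeff h k))\<^sup>2"
    proof -
      have "(cmod (of_real (eigval k) ^ Suc n))\<^sup>2 = ?r ^ Suc n"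
        by (simp only: norm_power norm_of_real power_mult[symmetric] mult.commute[of "Suc n" 2])
          (simp only: power_mult power2_abs)
      then have "(cmod (coeff h k))\<^sup>2 = ?r ^ Suc n * (cmod (coeff f k))\<^sup>2"
        by (simp only: Suc.prems(3) norm_mult power_mult_distrib)
      then show ?thesis by (simp only: distrib_right mult_1)
    qed
    finally show "norm ((cmod (of_real (eigval k) * coeff f k))\<^sup>2)
        \<le> (cmod (coeff f k))\<^sup>2 + (cmod (coeff h k))\<^sup>2"
      by (simp add: norm_mult power_mult_distrib)
  qed
  then obtain g where g: "g \<in> L2 S" "\<And>k. coeff g k = of_real (eigval k) * coeff f k"
    using riesz_fischer_L2 by metis
  have "\<exists>f'\<in>D. ae_eq S f f' \<and> ae_eq S g (sl S f')"
  proof (rule sl_adjoint)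
    fix u assume u: "u \<in> D"
    have "(\<lambda>k. coeff (sl S u) k * cnj (coeff f k)) sums L2_inner S (sl S u) f"
      using u by (intro parseval_L2 sl_D_L2 Suc.prems(1))
    moreover have "(\<lambda>k. coeff u k * cnj (coeff g k)) sums L2_inner S u g"
      using u by (intro parseval_L2 D_L2 g(1))
    ultimately show "L2_inner S (sl S u) f = L2_inner S u g"
      by (simp add: coeff_sl[OF u] g(2) mult_ac sums_unique2)
  qed (use Suc.prems g in auto)
  then obtain f' where f': "f' \<in> D" "ae_eq S f f'" "ae_eq S g (sl S f')" by blast
  have "\<exists>g'\<in>pow_dom n. ae_eq S g g' \<and> ae_eq S h (sl_pow S n g')"
    using g Suc.prems by (intro Suc.IH) (auto simp: mult_ac)
  then obtain g' where g': "g' \<in> pow_dom n" "ae_eq S g g'" "ae_eq S h (sl_pow S n g')" by blast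
  have g'f': "ae_eq S (sl S f') g'"
    using f'(3) g'(2) ae_eq_sym ae_eq_trans by blast
  have "ae_eq S h (sl_pow S (Suc n) f')"
    using g'(3) sl_pow_cong[OF ae_eq_sym[OF g'f'], of n] unfolding sl_pow_Suc by (rule ae_eq_trans)
  then show ?case using f' g' g'f' by auto
qed

text \<open>The domain of the \<open>n\<close>th power asks for \<open>L f, \<dots>, L\<^bsup>n-1\<^esup> f \<in> D\<close>, whence all quasi-derivatives up to order
  \<open>2n - 1\<close> have locally absolutely continuous representatives.\<close>

lemma pow_dom_facts:
  assumes "f \<in> pow_dom n"
  shows "f \<in> L2 S \<and> regular S n f \<and> sl_pow S n f \<in> L2 S \<and>
    (\<forall>k. coeff (sl_pow S n f) k = of_real (eigval k)^n * coeff f k)"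
  using assms
proof (induction n arbitrary: f)
  case (Suc n)
  then obtain g where f: "f \<in> D" and g: "g \<in> pow_dom n" "ae_eq S (sl S f) g" by auto
  note IH = Suc.IH[OF g(1)]
  have cong: "ae_eq S (sl_pow S n g) (sl_pow S (Suc n) f)"
    unfolding sl_pow_Suc by (rule ae_eq_sym[OF sl_pow_cong[OF g(2)]])
  have "regular S 1 f" using f D_max by (auto simp: sl_max_iff)
  moreover have "regular S n (sl S f)"
    using IH regular_cong[OF ae_eq_sym[OF g(2)]] by blast
  ultimately have "regular S (Suc n) f" by (simp add: regular_Suc)
  moreover have "sl_pow S (Suc n) f \<in> L2 S"
    using IH L2_ae_cong[OF SL _ cong] by blast
  moreover have "coeff (sl_pow S (Suc n) f) k = of_real (eigval k)^Suc n * coeff f k" for k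
  proof -
    have "coeff (sl_pow S (Suc n) f) k = coeff (sl_pow S n g) k"
      using coeff_cong[OF _ cong, of k] IH by simp
    also have "\<dots> = of_real (eigval k)^n * coeff (sl S f) k"
      using IH coeff_cong[OF sl_D_L2[OF f] g(2), of k] by simp
    finally show ?thesis by (simp add: coeff_sl[OF f])
  qed
  ultimately show ?case using D_L2[OF f] by blast
qed simp

lemma pow_dom_D: "n \<ge> 1 \<Longrightarrow> f \<in> pow_dom n \<Longrightarrow> f \<in> D"
  by (cases n) auto

lemma pow_dom_sl_max: "n \<ge> 1 \<Longrightarrow> f \<in> pow_dom n \<Longrightarrow> f \<in> sl_max S n"
  using pow_dom_facts[of f n] pow_dom_D[of n f] D_max by (auto simp: sl_max_iff)

text \<open>Both sides are \<open>\<Sum>\<^sub>k \<lambda>\<^sub>k\<^sup>n * coeff f k * cnj (coeff g k)\<close> with real \<open>\<lambda>\<^sub>k\<close>.\<close>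

lemma sl_pow_symmetric:
  assumes "f \<in> pow_dom n" "g \<in> pow_dom n"
  shows "L2_inner S (sl_pow S n f) g = L2_inner S f (sl_pow S n g)"
proof -
  note f = pow_dom_facts[OF assms(1)] and g = pow_dom_facts[OF assms(2)]
  have "(\<lambda>k. coeff (sl_pow S n f) k * cnj (coeff g k)) sums L2_inner S (sl_pow S n f) g"
    using f g by (intro parseval_L2) auto
  moreover have "(\<lambda>k. coeff f k * cnj (coeff (sl_pow S n g) k)) sums L2_inner S f (sl_pow S n g)"
    using f g by (intro parseval_L2) auto
  ultimately show ?thesis
    using f g by (simp add: mult_ac sums_unique2)
qed

lemma sl_bracket_pow_dom:
  assumes "n \<ge> 1" "f \<in> pow_dom n" "g \<in> pow_dom n"
  shows "sl_bracket S n f g = 0"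
  using assms by (simp add: sl_bracket_eq[OF SL] pow_dom_sl_max sl_pow_symmetric)

lemma pow_dom_if_coeff:
  assumes n: "n \<ge> 1" and f: "f \<in> sl_max S k" 
    and "h \<in> L2 S" "\<And>k. coeff h k = of_real (eigval k)^n * coeff f k"
  shows "f \<in> pow_dom n"
proof -
  obtain g where g: "g \<in> pow_dom n" "ae_eq S f g"
    using ex_pow_dom_if_coeff[of f h n] assms by (auto simp: sl_max_iff)
  then show ?thesis
    using sl_max_ae_eq_imp_eq[OF f pow_dom_sl_max[OF n g(1)] g(2)] by simp
qed

lemma scaled_P_L2: "(\<lambda>x. a * P k x) \<in> L2 S"
  using sq_integrable_scale[OF P_L2[unfolded L2_iff]] by (simp add: L2_iff)

lemma coeff_scaled_P: "coeff (\<lambda>x. of_real (eigval k)^n * P k x) j = of_real (eigval j)^n * coeff (P k) j"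
  using coeff_P[of j k] by (cases "j = k") (simp_all add: inner_on_scale_left)

lemma P_dom:
  assumes "n \<ge> 1"
  shows "P k \<in> pow_dom n"
  by (rule pow_dom_if_coeff[OF assms _ scaled_P_L2 coeff_scaled_P]) (use P_D D_max in blast)

lemma sl_pow_P:
  assumes "n \<ge> 1"
  shows "ae_eq S (sl_pow S n (P k)) (\<lambda>x. of_real (eigval k)^n * P k x)"
  using pow_dom_facts[OF P_dom[OF assms]] 
  by (intro ae_eq_if_coeff_eq scaled_P_L2) (auto simp only: coeff_scaled_P)

text \<open>The vanishing brackets say that \<open>sl_pow S n f\<close> has the coefficients \<open>\<lambda>\<^sub>k\<^sup>n * coeff f k\<close>. Thus the
  eigenfunctions alone, without the rest of the domain, already determine the domain of the \<open>n\<close>th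
  power inside the maximal domain.\<close>

lemma pow_dom_if_bracket_P:
  assumes n: "n \<ge> 1" and f: "f \<in> sl_max S n" and zero: "\<And>k. sl_bracket S n f (P k) = 0"
  shows "f \<in> pow_dom n"
proof (rule pow_dom_if_coeff[OF n f])
  show L2: "sl_pow S n f \<in> L2 S" using f by (simp add: sl_max_iff)
  have f2: "f \<in> L2 S" using f by (simp add: sl_max_iff)
  fix k
  have A: "sl_pow S n (P k) \<in> L2 S" using pow_dom_facts[OF P_dom[OF n]] by blast
  have "inner_on M (sl_pow S n f) (P k) = L2_inner S f (sl_pow S n (P k))"
    using zero[of k] L2 P_L2 by (simp add: sl_bracket_eq[OF SL f pow_dom_sl_max[OF n P_dom[OF n]]] inner_eq)
  also have "\<dots> = inner_on M f (\<lambda>x. of_real (eigval k)^n * P k x)"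
    using L2_inner_ae_cong[OF SL f2 A ae_eq_refl sl_pow_P[OF n]] by (simp add: inner_eq f2 scaled_P_L2)
  also have "\<dots> = of_real (eigval k)^n * inner_on M f (P k)"
    by (subst (1 2) inner_on_commute) (simp add: inner_on_scale_left)
  finally show "coeff (sl_pow S n f) k = of_real (eigval k)^n * coeff f k"
    by (simp add: inner_unit_eigf_right)
qed

section \<open>The maximal domain modulo the domain of the power\<close>

text \<open>The \<open>n\<close>th power \<open>A\<close> is self-adjoint, so \<open>A - \<i>\<close> is onto: dividing coefficients by \<open>\<lambda>\<^sub>k\<^sup>n - \<i>\<close>, whose
  modulus is at least \<open>1\<close>, solves \<open>(A - \<i>) g = sl_pow S n f - \<i> f\<close>. The difference \<open>f - g\<close> is then a
  deficiency element.\<close>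

lemma sl_max_decompose:
  assumes n: "n \<ge> 1" and f: "f \<in> sl_max S n"
  obtains g where "g \<in> pow_dom n" "(\<lambda>x. f x - g x) \<in> defect_space S n \<i>"
proof -
  define h where "h x = sl_pow S n f x + (- \<i>) * f x" for x
  have h: "h \<in> L2 S" unfolding h_def[abs_def]
    using f by (intro L2_add_mult[OF SL]) (auto simp: sl_max_iff)
  let ?l = "\<lambda>k. complex_of_real (eigval k ^ n)"
  have ge1: "cmod (?l k - \<i>) \<ge> 1" for k
    using abs_Im_le_cmod[of "?l k - \<i>"] by simp
  have nz: "?l k - \<i> \<noteq> 0" for k using ge1[of k] by force
  have "summable (\<lambda>k. (cmod (coeff h k))\<^sup>2)"
    using h by (intro bessel) (simp add: L2_iff)
  then have "summable (\<lambda>k. (cmod (coeff h k / (?l k - \<i>)))\<^sup>2)"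
  proof (rule summable_comparison_test')
    fix k :: nat
    have "cmod (coeff h k) / cmod (?l k - \<i>) \<le> cmod (coeff h k) / 1"
      using ge1[of k] by (intro divide_left_mono) auto
    then show "norm ((cmod (coeff h k / (?l k - \<i>)))\<^sup>2) \<le> (cmod (coeff h k))\<^sup>2"
      by (simp add: norm_divide power_mono)
  qed
  then obtain u where u: "u \<in> L2 S" "\<And>k. coeff u k = coeff h k / (?l k - \<i>)"
    using riesz_fischer_L2[of "\<lambda>k. coeff h k / (?l k - \<i>)"] by blast
  have h': "(\<lambda>x. h x + \<i> * u x) \<in> L2 S" by (rule L2_add_mult[OF SL h u(1)])
  have "coeff (\<lambda>x. h x + \<i> * u x) k = of_real (eigval k)^n * coeff u k" for k
  proof -
    have "coeff h k = (?l k - \<i>) * coeff u k" using u(2)[of k] nz[of k] by simp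
    then show ?thesis
      using h u(1) by (simp add: inner_on_add_mult_left L2_iff e_sq algebra_simps)
  qed
  from ex_pow_dom_if_coeff[OF u(1) h' this] obtain g
    where g: "g \<in> pow_dom n" "ae_eq S u g" "ae_eq S (\<lambda>x. h x + \<i> * u x) (sl_pow S n g)" by blast
  note g_max = pow_dom_sl_max[OF n g(1)]
  have "ae_eq S (sl_pow S n (\<lambda>x. f x + (-1) * g x)) (\<lambda>x. sl_pow S n f x + (-1) * sl_pow S n g x)"
    using f g_max by (intro regular_add_mult) (auto simp: sl_max_iff)
  also have "ae_eq S \<dots> (\<lambda>x. \<i> * (f x + (-1) * g x))"
    using g(2,3) unfolding ae_eq_def h_def by eventually_elim (auto simp: algebra_simps)
  finally have "(\<lambda>x. f x + (-1) * g x) \<in> defect_space S n \<i>"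
    using sl_max_add_mult[OF SL f g_max, of "-1"] by (simp add: defect_space_def)
  then show thesis using g(1) by (intro that) simp_all
qed

text \<open>A deficiency element in the domain of the \<open>n\<close>th power would be an eigenfunction with the nonreal
  eigenvalue \<open>\<i>\<close>.\<close>

lemma pow_dom_Int_defect_space:
  assumes n: "n \<ge> 1" and g: "g \<in> pow_dom n" "g \<in> defect_space S n \<i>"
  shows "g = (\<lambda>x. 0)"
proof -
  have max: "g \<in> sl_max S n" and ae: "ae_eq S (sl_pow S n g) (\<lambda>x. \<i> * g x)"
    using g(2) by (auto simp: defect_space_def)
  have "coeff g k = 0" for k
  proof -
    have "of_real (eigval k)^n * coeff g k = \<i> * coeff g k"
      using pow_dom_facts[OF g(1)] coeff_cong[OF _ ae, of k] by (simp add: inner_on_scale_left)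
    moreover have "complex_of_real (eigval k)^n \<noteq> \<i>"
      by (metis Im_complex_of_real imaginary_unit.sel(2) of_real_power zero_neq_one)
    ultimately show ?thesis by simp
  qed
  then have "ae_eq S g (\<lambda>x. 0)"
    using max by (intro ae_eq_if_coeff_eq) (auto simp: sl_max_iff L2_iff inner_on_def)
  moreover have "AC_loc S (\<lambda>x. 0)" by (simp add: AC_loc_def abs_cont_on_def)
  ultimately show ?thesis
    using max AC_loc_ae_eq_imp_eq[of S g "\<lambda>x. 0"] by (auto simp: sl_max_iff fun_eq_iff)
qed

lemma sl_bracket_sum:
  assumes n: "n \<ge> 1" and "finite K" "\<And>k. k \<in> K \<Longrightarrow> E k \<in> sl_max S n"
  shows "(\<lambda>x. \<Sum>k\<in>K. c k * E k x) \<in> sl_max S n"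
    and "h \<in> sl_max S n \<Longrightarrow>
      sl_bracket S n (\<lambda>x. \<Sum>k\<in>K. c k * E k x) h = (\<Sum>k\<in>K. c k * sl_bracket S n (E k) h)"
  using assms(2,3)
proof (induction K rule: finite_induct)
  case empty
  have P0: "P 0 \<in> sl_max S n" by (rule pow_dom_sl_max[OF n P_dom[OF n]])
  {
    case 1
    show ?case using sl_max_add_mult[OF SL P0 P0, of "-1"] by simp
  next
    case 2
    then show ?case using sl_bracket_add_mult[OF SL P0 P0, of h "-1"] by simp
  }
next
  case (insert k K)
  {
    case 1
    then show ?case
      using sl_max_add_mult[OF SL insert.IH(1), of "E k" "c k"] insert.hyps by (simp add: add.commute)
  next
    case 2
    then show ?case
      using sl_bracket_add_mult[OF SL insert.IH(1), of "E k" h "c k"] insert.IH(2) insert.hyps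
      by (simp add: add.commute)
  }
qed

text \<open>Let \<open>E j\<close> be a basis of the deficiency space. A combination of the \<open>E j\<close> whose brackets with all
  eigenfunctions vanish lies in the domain of the power, hence is zero; so the rows
  \<open>[E j, P k]\<^sub>j\<close> have no common kernel, and \<open>N\<close> of them form a nonsingular matrix. Its trivial kernel
  on the row side gives independence modulo the minimal domain, by testing with the \<open>E j\<close>. Its trivial
  kernel on the column side shows that a function annihilated by the chosen eigenfunctions has no
  component in the deficiency space.\<close>

lemma GKN_eigenfunctions:
  assumes n: "n \<ge> 1" and dim: "has_dim (defect_space S n \<i>) N"
  shows "\<exists>\<kappa>. lin_indep_mod_min S n N (\<lambda>i. P (\<kappa> i)) \<and>
    (\<forall>i<N. \<forall>j<N. sl_bracket S n (P (\<kappa> i)) (P (\<kappa> j)) = 0) \<and>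
    pow_dom n = {f \<in> sl_max S n. \<forall>i<N. sl_bracket S n f (P (\<kappa> i)) = 0}"
proof -
  obtain B where B: "finite B" "card B = N" "cfun.independent B" "cfun.span B = defect_space S n \<i>"
    using dim by (auto simp: has_dim_def)
  obtain E where E: "bij_betw E {..<N} B"
    using ex_bij_betw_nat_finite[OF B(1)] B(2) by (auto simp: atLeast0LessThan)
  \<comment> \<open>combinations of the set \<open>B\<close> in the function space, rewritten as pointwise sums over \<open>{..<N}\<close>\<close>
  have reindex: "(\<Sum>b\<in>B. (\<lambda>x. u b * b x)) = (\<lambda>x. \<Sum>j<N. u (E j) * E j x)" for u
    by (rule ext) (simp add: sum_fun_apply sum.reindex_bij_betw[OF E, symmetric])
  have E_defect: "E j \<in> defect_space S n \<i>" if "j < N" for j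
    using bij_betwE[OF E] that cfun.span_base[of "E j" B] B(4) by blast
  then have E_max: "E j \<in> sl_max S n" if "j < N" for j
    using that by (simp add: defect_space_def)
  have P_max: "P k \<in> sl_max S n" for k
    by (rule pow_dom_sl_max[OF n P_dom[OF n]])
  have span: "(\<lambda>x. \<Sum>j<N. c j * E j x) \<in> defect_space S n \<i>" for c
  proof -
    have "(\<Sum>b\<in>B. (\<lambda>x. c (the_inv_into {..<N} E b) * b x)) \<in> cfun.span B"
      by (intro cfun.span_sum cfun.span_scale cfun.span_base)
    moreover have "(\<Sum>b\<in>B. (\<lambda>x. c (the_inv_into {..<N} E b) * b x)) = (\<lambda>x. \<Sum>j<N. c j * E j x)"
      unfolding reindex using E by (auto simp: the_inv_into_f_f bij_betw_def intro!: ext sum.cong)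
    ultimately show ?thesis using B(4) by simp
  qed
  have spanned: "\<exists>c. f = (\<lambda>x. \<Sum>j<N. c j * E j x)" if "f \<in> defect_space S n \<i>" for f
  proof -
    have "f \<in> range (\<lambda>u. \<Sum>b\<in>B. (\<lambda>x. u b * b x))"
      using that B(4) cfun.span_finite[OF B(1)] by simp
    then show ?thesis unfolding reindex by auto
  qed
  have indep: "\<forall>j<N. c j = 0" if zero: "(\<lambda>x. \<Sum>j<N. c j * E j x) = (\<lambda>x. 0)" for c
  proof -
    have eq: "(\<Sum>b\<in>B. (\<lambda>x. c (the_inv_into {..<N} E b) * b x)) = (\<lambda>x. \<Sum>j<N. c j * E j x)"
      unfolding reindex using E by (auto simp: the_inv_into_f_f bij_betw_def intro!: ext sum.cong)
    have "c j = 0" if j: "j < N" for j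
    proof (rule ccontr)
      assume "c j \<noteq> 0"
      moreover have "E j \<in> B" "the_inv_into {..<N} E (E j) = j"
        using E j by (auto simp: bij_betw_def intro: the_inv_into_f_f)
      ultimately have "\<exists>b\<in>B. c (the_inv_into {..<N} E b) \<noteq> 0" by metis
      moreover have "(\<Sum>b\<in>B. (\<lambda>x. c (the_inv_into {..<N} E b) * b x)) = 0"
        unfolding eq zero by (simp add: zero_fun_def)
      ultimately have "cfun.dependent B"
        by (intro iffD2[OF cfun.dependent_finite[OF B(1)]] exI[of _ "\<lambda>b. c (the_inv_into {..<N} E b)"] conjI)
      then show False using B(3) by contradiction
    qed
    then show ?thesis by blast
  qed
  have bracket_comb: "sl_bracket S n (\<lambda>x. \<Sum>j<N. c j * E j x) (P k) = (\<Sum>j<N. c j * sl_bracket S n (E j) (P k))"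
    for c k
    using sl_bracket_sum(2)[OF n _ _ P_max, of "{..<N}" E c] E_max by auto
  have kernel: "\<forall>j<N. c j = 0" if "\<And>k. (\<Sum>j<N. c j * sl_bracket S n (E j) (P k)) = 0" for c
  proof (rule indep, rule pow_dom_Int_defect_space[OF n _ span])
    show "(\<lambda>x. \<Sum>j<N. c j * E j x) \<in> pow_dom n"
    proof (rule pow_dom_if_bracket_P[OF n])
      show "(\<lambda>x. \<Sum>j<N. c j * E j x) \<in> sl_max S n"
        using span[of c] by (simp add: defect_space_def)
      show "sl_bracket S n (\<lambda>x. \<Sum>j<N. c j * E j x) (P k) = 0" for k
        using that by (simp add: bracket_comb)
    qed
  qed
  have "\<exists>\<kappa>. (\<forall>c. (\<forall>i<N. (\<Sum>j<N. c j * sl_bracket S n (E j) (P (\<kappa> i))) = 0) \<longrightarrow> (\<forall>j<N. c j = 0)) \<and>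
      (\<forall>\<alpha>. (\<forall>j<N. (\<Sum>i<N. \<alpha> i * sl_bracket S n (E j) (P (\<kappa> i))) = 0) \<longrightarrow> (\<forall>i<N. \<alpha> i = 0))"
    by (rule nonsingular_square_rows) (rule kernel)
  then obtain \<kappa> where
    "\<forall>c. (\<forall>i<N. (\<Sum>j<N. c j * sl_bracket S n (E j) (P (\<kappa> i))) = 0) \<longrightarrow> (\<forall>j<N. c j = 0)"
    "\<forall>\<alpha>. (\<forall>j<N. (\<Sum>i<N. \<alpha> i * sl_bracket S n (E j) (P (\<kappa> i))) = 0) \<longrightarrow> (\<forall>i<N. \<alpha> i = 0)"
    by (elim exE conjE)
  note cols = this(1)[THEN spec, THEN mp] and rows = this(2)[THEN spec, THEN mp]
  have "lin_indep_mod_min S n N (\<lambda>i. P (\<kappa> i))"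
    unfolding lin_indep_mod_min_def
  proof (intro conjI allI impI P_max)
    fix \<alpha> i assume min: "(\<lambda>x. \<Sum>i<N. \<alpha> i * P (\<kappa> i) x) \<in> sl_min S n" and i: "i < N"
    have "(\<Sum>i<N. cnj (\<alpha> i) * sl_bracket S n (E j) (P (\<kappa> i))) = 0" if j: "j < N" for j
    proof -
      have "sl_bracket S n (\<lambda>x. \<Sum>i<N. \<alpha> i * P (\<kappa> i) x) (E j) = 0"
        using min E_max[OF j] by (simp add: sl_min_def)
      then have "(\<Sum>i<N. \<alpha> i * sl_bracket S n (P (\<kappa> i)) (E j)) = 0"
        using sl_bracket_sum(2)[OF n _ _ E_max[OF j], of "{..<N}" "\<lambda>i. P (\<kappa> i)" \<alpha>] P_max by simp
      then have "cnj (\<Sum>i<N. \<alpha> i * cnj (sl_bracket S n (E j) (P (\<kappa> i)))) = 0"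
        by (simp add: sl_bracket_commute[OF SL E_max[OF j] P_max] sum_negf)
      then show ?thesis by simp
    qed
    then show "\<alpha> i = 0" using rows[of "\<lambda>i. cnj (\<alpha> i)"] i by simp
  qed
  moreover have "\<forall>i<N. \<forall>j<N. sl_bracket S n (P (\<kappa> i)) (P (\<kappa> j)) = 0"
    by (simp add: sl_bracket_pow_dom[OF n P_dom[OF n] P_dom[OF n]])
  moreover have "pow_dom n = {f \<in> sl_max S n. \<forall>i<N. sl_bracket S n f (P (\<kappa> i)) = 0}"
  proof (intro equalityI subsetI)
    fix f assume "f \<in> pow_dom n"
    then show "f \<in> {f \<in> sl_max S n. \<forall>i<N. sl_bracket S n f (P (\<kappa> i)) = 0}"
      using sl_bracket_pow_dom[OF n _ P_dom[OF n]] pow_dom_sl_max[OF n] by simp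
  next
    fix f assume "f \<in> {f \<in> sl_max S n. \<forall>i<N. sl_bracket S n f (P (\<kappa> i)) = 0}"
    then have f: "f \<in> sl_max S n" "\<And>i. i < N \<Longrightarrow> sl_bracket S n f (P (\<kappa> i)) = 0" by auto
    obtain g where g: "g \<in> pow_dom n" "(\<lambda>x. f x - g x) \<in> defect_space S n \<i>"
      by (rule sl_max_decompose[OF n f(1)])
    obtain c where c: "(\<lambda>x. f x - g x) = (\<lambda>x. \<Sum>j<N. c j * E j x)"
      using spanned[OF g(2)] by blast
    have "\<forall>j<N. c j = 0"
    proof (rule cols, intro allI impI)
      fix i assume i: "i < N"
      have "sl_bracket S n (\<lambda>x. f x + (-1) * g x) (P (\<kappa> i)) = 0"
        using f(2)[OF i] sl_bracket_pow_dom[OF n g(1) P_dom[OF n]]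
        by (simp only: sl_bracket_add_mult[OF SL f(1) pow_dom_sl_max[OF n g(1)] P_max]) simp
      then show "(\<Sum>j<N. c j * sl_bracket S n (E j) (P (\<kappa> i))) = 0"
        by (simp add: c flip: bracket_comb)
    qed
    then have "f x - g x = 0" for x
      using fun_cong[OF c, of x] by simp
    then have "f = g" by (simp add: fun_eq_iff)
    then show "f \<in> pow_dom n" using g(1) by simp
  qed
  ultimately show ?thesis by blast
qed

lemma pow_dom_shift: "op_pow_dom S (op_shift (sl S) c) D n = pow_dom n"
  using D_L2 sl_lin by (intro op_pow_dom_shift[OF SL] subsetI)

end

theorem theorem5p2:
  fixes S :: sl_expr and D :: "(real \<Rightarrow> complex) set"
    and P :: "nat \<Rightarrow> real \<Rightarrow> complex" and m n :: nat
  assumes "sturm_liouville S"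
    and "D \<subseteq> sl_max S 1"
    and "self_adjoint S (sl S) D"
    and "\<exists>\<kappa>. bounded_below_by S (sl S) D \<kappa>"
    and "\<And>k. eigenfunction S (sl S) D (P k)"
    and "complete_orthogonal_system S P"
    and "sl_min S 1 \<subseteq> D"
    and "deficiency_indices S 1 m m"
    and "n \<ge> 1"
    and "deficiency_indices S n (n * m) (n * m)"
  shows "\<exists>k :: nat \<Rightarrow> nat.
           lin_indep_mod_min S n (n * m) (\<lambda>i. P (k i)) \<and>
           (\<forall>i < n * m. \<forall>j < n * m. sl_bracket S n (P (k i)) (P (k j)) = 0) \<and>
           op_pow_dom S (sl S) D n
             = {f \<in> sl_max S n. \<forall>i < n * m. sl_bracket S n f (P (k i)) = 0} \<and>
           (\<forall>c \<kappa>. \<kappa> > 0 \<and> bounded_below_by S (op_shift (sl S) c) D \<kappa> \<longrightarrow>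
              left_definite_space_even S (op_shift (sl S) c) D n
                = {f \<in> sl_max S n. \<forall>i < n * m. sl_bracket S n f (P (k i)) = 0})"
proof -
  interpret sl_eigenbasis S D P
    by (rule sl_eigenbasis.intro) (fact assms)+
  have "has_dim (defect_space S n \<i>) (n * m)"
    using assms(10) by (simp add: deficiency_indices_def)
  from GKN_eigenfunctions[OF assms(9) this] obtain k where
    k: "lin_indep_mod_min S n (n * m) (\<lambda>i. P (k i))"
      "\<forall>i < n * m. \<forall>j < n * m. sl_bracket S n (P (k i)) (P (k j)) = 0"
      "pow_dom n = {f \<in> sl_max S n. \<forall>i < n * m. sl_bracket S n f (P (k i)) = 0}"
    by (elim exE conjE)
  show ?thesis
    unfolding left_definite_space_even_def pow_dom_shift
  proof (rule exI[of _ k], intro conjI)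
    show "\<forall>c \<kappa>. \<kappa> > 0 \<and> bounded_below_by S (op_shift (sl S) c) D \<kappa> \<longrightarrow>
        pow_dom n = {f \<in> sl_max S n. \<forall>i < n * m. sl_bracket S n f (P (k i)) = 0}"
      by (intro allI impI k(3))
  qed (fact k)+
qed

end
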